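(* Let $G$ be a probability distribution on $[0,\infty)$, let $\boldsymbol X=(X_0,X_1,\dots)$ be a homogeneous Markov chain on $[0,\infty)$ with transition kernel $K\in D(G)$, and let $\boldsymbol T=(T_0,T_1,\dots)$ be a Markov chain on $[0,\infty)$ with transition kernel $K^*$, a tail kernel associated with $G$ with an arbitrary (unspecified) boundary distribution $H$. For $m\ge 1$ define $$\pi^{(t)}_m(u,\cdot)=\mathsf P_{tu}\Big[\Big(\tfrac{X_1}{t},\dots,\tfrac{X_m}{t}\Big)\in\cdot\Big],\qquad \pi_m(u,\cdot)=\mathsf P_u\big[(T_1,\dots,T_m)\in\cdot\,\big],$$ as measures on $[0,\infty]^m$, and let $\mathbb E'_m=(0,\infty]^{m-1}\times[0,\infty]$ (so $\mathbb E'_1=[0,\infty]$). Let $u_t=u(t)$ be a non-negative function such that $u_t\to u>0$ as $t\to\infty$. (a) The restrictions to $\mathbb E'_m$, $$\mu^{(t)}_m(u,\cdot):=\pi^{(t)}_m(u,\cdot\cap\mathbb E'_m),\qquad \mu_m(u,\cdot):=\pi_m(u,\cdot\cap\mathbb E'_m),$$ satisfy $\mu^{(t)}_m(u_t,\cdot)\stackrel{v}{\longrightarrow}\mu_m(u,\cdot)$ in $\mathbb M_+(\mathbb E'_m)$ as $t\to\infty$. (b) If $G(\{0\})=0$, then $\pi^{(t)}_m(u_t,\cdot)\Rightarrow\pi_m(u,\cdot)$ on $[0,\infty]^m$ as $t\to\infty$.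
   Context: A Markov transition kernel $K:[0,\infty)\times\mathcal B[0,\infty)\to[0,1]$ is in the domain of attraction of $G$, written $K\in D(G)$, if $K(t,t\,\cdot)\Rightarrow G(\cdot)$ on $[0,\infty]$ as $t\to\infty$ (weak convergence; $tA=\{ta:a\in A\}$). The tail kernel associated with $G$, with boundary distribution $H$ (a probability distribution on $[0,\infty)$), is $K^*(y,A)=G(y^{-1}A)$ for $y>0$ and $K^*(0,A)=H(A)$. $\mathsf P_x[\cdot]$ denotes the conditional probability given that the chain's initial state is $x$. For a locally compact space $\mathbb E$ with countable base, $\mathbb M_+(\mathbb E)$ is the space of non-negative Radon measures on $\mathbb E$, and $\mu_t\stackrel{v}{\to}\mu$ means $\int f\,d\mu_t\to\int f\,d\mu$ for all non-negative continuous $f$ with compact support in $\mathbb E$. Measures on $[0,\infty)^m$ are regarded as measures on $[0,\infty]^m$. *)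

theory Defs
  imports "HOL-Probability.Probability"
begin

section \<open>Kernels on the half-line and Markov chains\<close>

text \<open>A Markov transition kernel on \<open>[0,\<infinity>)\<close> is an element \<open>K\<close> of
  \<open>half_line \<rightarrow>\<^sub>M prob_algebra half_line\<close>, with \<open>K(x, A) = measure (K x) A\<close>.
  The compact interval \<open>[0,\<infinity>]\<close> is the type \<^typ>\<open>ennreal\<close> with its order topology, and
  \<open>[0,\<infinity>)\<close> is embedded into it by \<^const>\<open>ennreal\<close>.\<close>

definition half_line :: "real measure" where
  "half_line = restrict_space borel {0..}"

definition past :: "'a measure \<Rightarrow> (nat \<Rightarrow> 'a \<Rightarrow> real) \<Rightarrow> nat \<Rightarrow> 'a measure" where
  "past M X n = vimage_algebra (space M) (\<lambda>\<omega>. \<lambda>i\<in>{..n}. X i \<omega>) (\<Pi>\<^sub>M i\<in>{..n}. half_line)"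

text \<open>Under the probability measure \<open>M\<close>, the process \<open>X\<close> is a homogeneous Markov chain on
  \<open>[0,\<infinity>)\<close> with transition kernel \<open>K\<close> and initial state \<open>x\<close>.\<close>

definition markov_chain_from ::
    "(real \<Rightarrow> real measure) \<Rightarrow> real \<Rightarrow> 'a measure \<Rightarrow> (nat \<Rightarrow> 'a \<Rightarrow> real) \<Rightarrow> bool" where
  "markov_chain_from K x M X \<longleftrightarrow>
     prob_space M \<and>
     (\<forall>n. X n \<in> M \<rightarrow>\<^sub>M half_line) \<and>
     (AE \<omega> in M. X 0 \<omega> = x) \<and>
     (\<forall>n. \<forall>A\<in>sets half_line.
        AE \<omega> in M. real_cond_exp M (past M X n) (\<lambda>\<omega>'. indicator A (X (Suc n) \<omega>')) \<omega>
          = measure (K (X n \<omega>)) A)"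

text \<open>For \<open>y > 0\<close> this is \<open>K\<^sup>*(y, A) = G(y\<^sup>-\<^sup>1 A)\<close>; of the states \<open>y \<le> 0\<close> only \<open>y = 0\<close> lies in
  the state space.\<close>

definition tail_kernel :: "real measure \<Rightarrow> real measure \<Rightarrow> real \<Rightarrow> real measure" where
  "tail_kernel G H y = (if y > 0 then distr G half_line (\<lambda>x. y * x) else H)"

section \<open>Weak and vague convergence\<close>

definition weak_conv_on ::
    "'b topology \<Rightarrow> ('t \<Rightarrow> 'b measure) \<Rightarrow> 'b measure \<Rightarrow> 't filter \<Rightarrow> bool" where
  "weak_conv_on S \<mu> \<nu> F \<longleftrightarrow>
     (\<forall>f. continuous_map S euclideanreal f \<and> bounded (f ` topspace S) \<longrightarrow>
        ((\<lambda>t. \<integral>x. f x \<partial>(\<mu> t)) \<longlongrightarrow> (\<integral>x. f x \<partial>\<nu>)) F)"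

text \<open>\<open>M\<^sub>+(S)\<close>: on a locally compact Hausdorff space with countable base, the non-negative Radon
  measures are the Borel measures that are finite on compact sets.\<close>

definition radon_measures :: "'b topology \<Rightarrow> 'b measure set" where
  "radon_measures S =
     {\<mu>. space \<mu> = topspace S \<and>
         sets \<mu> = sigma_sets (topspace S) {U. openin S U} \<and>
         (\<forall>C. compactin S C \<longrightarrow> emeasure \<mu> C < \<infinity>)}"

definition vague_conv_on ::
    "'b topology \<Rightarrow> ('t \<Rightarrow> 'b measure) \<Rightarrow> 'b measure \<Rightarrow> 't filter \<Rightarrow> bool" where
  "vague_conv_on S \<mu> \<nu> F \<longleftrightarrow>
     (\<forall>\<^sub>F t in F. \<mu> t \<in> radon_measures S) \<and> \<nu> \<in> radon_measures S \<and>
     (\<forall>f. continuous_map S euclideanreal f \<and> (\<forall>x\<in>topspace S. 0 \<le> f x) \<and>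
          compactin S (S closure_of {x \<in> topspace S. f x \<noteq> 0}) \<longrightarrow>
        ((\<lambda>t. \<integral>x. f x \<partial>(\<mu> t)) \<longlongrightarrow> (\<integral>x. f x \<partial>\<nu>)) F)"

text \<open>\<open>K \<in> D(G)\<close>. Since \<open>x \<in> tA\<close> iff \<open>x / t \<in> A\<close>, the measure \<open>K(t, t \<cdot>)\<close> is the image of
  \<open>K(t, \<cdot>)\<close> under division by \<open>t\<close>.\<close>

definition in_domain_of_attraction ::
    "(real \<Rightarrow> real measure) \<Rightarrow> real measure \<Rightarrow> bool" where
  "in_domain_of_attraction K G \<longleftrightarrow>
     weak_conv_on (euclidean :: ennreal topology)
       (\<lambda>t::real. distr (K t) borel (\<lambda>x. ennreal (x / t))) (distr G borel ennreal) at_top"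

section \<open>Finite-dimensional laws\<close>

text \<open>Points of \<open>[0,\<infinity>]\<^sup>m\<close> are extensional functions on the index set \<open>{1..m}\<close>.\<close>

definition cube_top :: "nat \<Rightarrow> (nat \<Rightarrow> ennreal) topology" where
  "cube_top m = product_topology (\<lambda>_. euclidean) {1..m}"

definition cube_borel :: "nat \<Rightarrow> (nat \<Rightarrow> ennreal) measure" where
  "cube_borel m = (\<Pi>\<^sub>M i\<in>{1..m}. borel)"

text \<open>\<open>(0,\<infinity>]\<^sup>m\<^sup>-\<^sup>1 \<times> [0,\<infinity>]\<close>\<close>

definition E' :: "nat \<Rightarrow> (nat \<Rightarrow> ennreal) set" where
  "E' m = {x \<in> {1..m} \<rightarrow>\<^sub>E UNIV. \<forall>i\<in>{1..<m}. 0 < x i}"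

text \<open>\<open>P x\<close> and \<open>Q x\<close> play the role of the conditional law given that the chain
  starts in \<open>x\<close>.\<close>

definition pi_scaled ::
    "(real \<Rightarrow> 'a measure) \<Rightarrow> (nat \<Rightarrow> 'a \<Rightarrow> real) \<Rightarrow> nat \<Rightarrow> real \<Rightarrow> real \<Rightarrow> (nat \<Rightarrow> ennreal) measure" where
  "pi_scaled P X m t u =
     distr (P (t * u)) (cube_borel m) (\<lambda>\<omega>. \<lambda>i\<in>{1..m}. ennreal (X i \<omega> / t))"

definition pi_tail ::
    "(real \<Rightarrow> 'b measure) \<Rightarrow> (nat \<Rightarrow> 'b \<Rightarrow> real) \<Rightarrow> nat \<Rightarrow> real \<Rightarrow> (nat \<Rightarrow> ennreal) measure" where
  "pi_tail Q T m u = distr (Q u) (cube_borel m) (\<lambda>\<omega>. \<lambda>i\<in>{1..m}. ennreal (T i \<omega>))"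

definition mu_scaled ::
    "(real \<Rightarrow> 'a measure) \<Rightarrow> (nat \<Rightarrow> 'a \<Rightarrow> real) \<Rightarrow> nat \<Rightarrow> real \<Rightarrow> real \<Rightarrow> (nat \<Rightarrow> ennreal) measure" where
  "mu_scaled P X m t u = restrict_space (pi_scaled P X m t u) (E' m)"

definition mu_tail ::
    "(real \<Rightarrow> 'b measure) \<Rightarrow> (nat \<Rightarrow> 'b \<Rightarrow> real) \<Rightarrow> nat \<Rightarrow> real \<Rightarrow> (nat \<Rightarrow> ennreal) measure" where
  "mu_tail Q T m u = restrict_space (pi_tail Q T m u) (E' m)"

end

theory Submission
  imports Defs
begin

section \<open>Convergence of a rescaled Markov chain to its tail chain\<close>

text \<open>An expectation along the chain is an iterated integral against the kernel, so it suffices to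
  pass to the limit in one integration at a time, starting with the last. Writing
  \<open>s = t \<cdot> v\<^sub>t\<close> with \<open>v\<^sub>t \<rightarrow> v > 0\<close>, one step of the rescaled chain
  from \<open>v\<^sub>t\<close> is \<open>v\<^sub>t \<cdot> (X\<^sub>1 / s)\<close>, and Skorohod's theorem realises
  \<open>X\<^sub>1 / s\<close> as a sequence converging pointwise to a variable with law \<open>G\<close>. Dominated
  convergence then transports continuous convergence of the integrands from step \<open>i + 1\<close> to
  step \<open>i\<close>. The argument breaks down only at the state \<open>0\<close>, which is either \<open>G\<close>-null or
  harmless because the test function, continuous on the compact cube and vanishing off \<open>E' m\<close>, is
  small uniformly in all other coordinates when an intermediate coordinate is small.\<close>

subsection \<open>Iterated integrals along a kernel\<close>

lemma space_half_line [simp]: "space half_line = {0..}"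
  by (simp add: half_line_def space_restrict_space)

lemma measurable_half_lineI:
  "f \<in> borel_measurable M \<Longrightarrow> (\<And>x. x \<in> space M \<Longrightarrow> 0 \<le> f x) \<Longrightarrow> f \<in> M \<rightarrow>\<^sub>M half_line"
  unfolding half_line_def by (intro measurable_restrict_space2) auto

lemma measurable_half_lineD:
  "f \<in> M \<rightarrow>\<^sub>M half_line \<Longrightarrow> f \<in> borel_measurable M"
  unfolding half_line_def by (rule measurable_restrict_space2_iff[THEN iffD1, THEN conjunct1])

lemma measurable_half_line_borel:
  "f \<in> borel_measurable borel \<Longrightarrow> f \<in> borel_measurable half_line"
  unfolding half_line_def by (rule measurable_restrict_space1)

lemma half_line_ident [measurable]: "(\<lambda>x. x) \<in> borel_measurable half_line"
  by (rule measurable_half_line_borel) simp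

abbreviation paths :: "(nat \<Rightarrow> real) measure" where
  "paths \<equiv> \<Pi>\<^sub>M i\<in>UNIV. half_line"

lemma space_paths: "\<omega> \<in> space paths \<longleftrightarrow> (\<forall>i. 0 \<le> \<omega> i)"
  by (auto simp: space_PiM)

lemma path_component: "(\<lambda>\<omega>. \<omega> i) \<in> paths \<rightarrow>\<^sub>M half_line"
  by (rule measurable_component_singleton) simp

lemma fun_upd_paths [measurable]:
  "(\<lambda>z. fun_upd (fst z) i (snd z)) \<in> paths \<Otimes>\<^sub>M half_line \<rightarrow>\<^sub>M paths"
  by (rule measurable_fun_upd[where J = UNIV]) auto

lemma fun_upd_paths':
  assumes "\<omega> \<in> space paths"
  shows "(\<lambda>y. fun_upd \<omega> i y) \<in> half_line \<rightarrow>\<^sub>M paths"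
  using measurable_Pair2[OF fun_upd_paths assms] by simp

text \<open>\<open>k\<close> transitions, the first one from coordinate \<open>i\<close> to coordinate \<open>i + 1\<close>; the path
  records the visited states, so that \<open>F\<close> may depend on all of them.\<close>

primrec iter_integral ::
    "(real \<Rightarrow> real measure) \<Rightarrow> ((nat \<Rightarrow> real) \<Rightarrow> real) \<Rightarrow> nat \<Rightarrow> nat \<Rightarrow> (nat \<Rightarrow> real) \<Rightarrow> real" where
  "iter_integral K F 0 i = F"
| "iter_integral K F (Suc k) i =
     (\<lambda>\<omega>. \<integral>y. iter_integral K F k (Suc i) (fun_upd \<omega> (Suc i) y) \<partial>K (\<omega> i))"

lemma kernel_prob_space:
  assumes "K \<in> half_line \<rightarrow>\<^sub>M prob_algebra half_line" "0 \<le> x"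
  shows "prob_space (K x)" "sets (K x) = sets half_line" "space (K x) = {0..}"
proof -
  have "K x \<in> space (prob_algebra half_line)"
    using measurable_space[OF assms(1)] assms(2) by simp
  then show "prob_space (K x)" "sets (K x) = sets half_line"
    by (auto simp: space_prob_algebra)
  then show "space (K x) = {0..}"
    using sets_eq_imp_space_eq[of "K x" half_line] by simp
qed

text \<open>The parameter \<open>x\<close> also enters the integrand. Integrating instead against
  the image of \<open>L x\<close> under \<open>y \<mapsto> (x, y)\<close> makes the integrand a
  fixed function on the product space, so that only the measure varies, and it does so measurably in
  \<open>x\<close>.\<close>

lemma kernel_integral_measurable:
  fixes f :: "'a \<Rightarrow> 'b \<Rightarrow> real"
  assumes f [measurable]: "(\<lambda>(x, y). f x y) \<in> borel_measurable (M \<Otimes>\<^sub>M N)"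
    and L [measurable]: "L \<in> M \<rightarrow>\<^sub>M subprob_algebra N"
  shows "(\<lambda>x. \<integral>y. f x y \<partial>L x) \<in> borel_measurable M"
proof -
  note integral_measurable_subprob_algebra[measurable] measurable_distr2[measurable]
  have "(\<lambda>x. \<integral>z. (\<lambda>(x, y). f x y) z \<partial>distr (L x) (M \<Otimes>\<^sub>M N) (\<lambda>y. (x, y))) \<in> borel_measurable M"
    by measurable
  then show ?thesis
    by (rule measurable_cong[THEN iffD1, rotated])
       (subst integral_distr, auto dest: measurable_space[OF L] simp: space_subprob_algebra cong: measurable_cong_sets)
qed

lemma iter_integral_measurable:
  assumes K: "K \<in> half_line \<rightarrow>\<^sub>M prob_algebra half_line" and F: "F \<in> borel_measurable paths"
  shows "iter_integral K F k i \<in> borel_measurable paths"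
proof (induction k arbitrary: i)
  case (Suc k)
  have "(\<lambda>(\<omega>, y). iter_integral K F k (Suc i) (fun_upd \<omega> (Suc i) y)) \<in> borel_measurable (paths \<Otimes>\<^sub>M half_line)"
    unfolding split_beta' by (rule measurable_compose[OF fun_upd_paths Suc])
  moreover have "(\<lambda>\<omega>. K (\<omega> i)) \<in> paths \<rightarrow>\<^sub>M subprob_algebra half_line"
    by (rule measurable_compose[OF _ measurable_prob_algebraD[OF K]]) simp
  ultimately show ?case
    unfolding iter_integral.simps by (rule kernel_integral_measurable)
qed (simp add: F)

text \<open>A non-integrable \<open>f\<close> has Bochner integral 0, and there the bound rests on
  \<open>0 \<le> B\<close>.\<close>

lemma (in prob_space) abs_integral_le:
  fixes f :: "'a \<Rightarrow> real"
  assumes "0 \<le> B" "\<And>x. x \<in> space M \<Longrightarrow> \<bar>f x\<bar> \<le> B"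
  shows "\<bar>\<integral>x. f x \<partial>M\<bar> \<le> B"
proof (cases "integrable M f")
  case True
  have "\<bar>\<integral>x. f x \<partial>M\<bar> \<le> (\<integral>x. \<bar>f x\<bar> \<partial>M)" by (rule integral_abs_bound)
  also have "\<dots> \<le> B" using True assms by (intro integral_le_const) auto
  finally show ?thesis .
qed (simp add: not_integrable_integral_eq assms)

text \<open>Transitions starting from coordinate \<open>i\<close> overwrite only later coordinates,
  so \<open>F\<close> has to be controlled only on paths sharing the history of
  \<open>\<omega>\<close> up to \<open>i\<close>. This local form later turns smallness of
  \<open>F\<close> near a zero coordinate into smallness of the whole iterated integral.\<close>

lemma iter_integral_bound:
  assumes K: "K \<in> half_line \<rightarrow>\<^sub>M prob_algebra half_line" and B: "0 \<le> B"
    and F: "\<And>\<omega>'. \<omega>' \<in> space paths \<Longrightarrow> (\<forall>j\<le>i. \<omega>' j = \<omega> j) \<Longrightarrow> \<bar>F \<omega>'\<bar> \<le> B"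
    and \<omega>: "\<omega> \<in> space paths"
  shows "\<bar>iter_integral K F k i \<omega>\<bar> \<le> B"
  using F \<omega>
proof (induction k arbitrary: i \<omega>)
  case (Suc k)
  have nn: "0 \<le> \<omega> i" using Suc by (simp add: space_paths)
  interpret prob_space "K (\<omega> i)" by (rule kernel_prob_space[OF K nn])
  show ?case unfolding iter_integral.simps
  proof (rule abs_integral_le[OF B])
    fix y assume "y \<in> space (K (\<omega> i))"
    then have y: "0 \<le> y" using kernel_prob_space(3)[OF K nn] by simp
    show "\<bar>iter_integral K F k (Suc i) (fun_upd \<omega> (Suc i) y)\<bar> \<le> B"
      by (rule Suc.IH) (use Suc.prems y in \<open>auto simp: space_paths le_Suc_eq\<close>)
  qed
qed auto

text \<open>Filling up with 0 after time \<open>n\<close> places histories of every length in the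
  one space \<open>paths\<close>, so that measurability and induction need not deal with varying
  index sets.\<close>

definition stopped :: "nat \<Rightarrow> (nat \<Rightarrow> real) \<Rightarrow> nat \<Rightarrow> real" where
  "stopped n \<omega> = (\<lambda>j. if j \<le> n then \<omega> j else 0)"

lemma stopped_Suc: "stopped (Suc n) \<omega> = fun_upd (stopped n \<omega>) (Suc n) (\<omega> (Suc n))"
  by (auto simp: stopped_def)

text \<open>The conditional expectations of the chain are taken given \<open>past\<close>. The
  stopped path is a function of the coordinates generating \<open>past\<close>, so every measurable
  function of the history is measurable for it.\<close>

lemma past_facts:
  assumes X: "\<And>n. X n \<in> M \<rightarrow>\<^sub>M half_line"
  shows "subalgebra M (past M X n)"
    and "(\<lambda>\<omega>. stopped n (\<lambda>i. X i \<omega>)) \<in> past M X n \<rightarrow>\<^sub>M paths"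
proof -
  have *: "(\<lambda>\<omega>. \<lambda>i\<in>{..n}. X i \<omega>) \<in> M \<rightarrow>\<^sub>M (\<Pi>\<^sub>M i\<in>{..n}. half_line)"
    by (intro measurable_restrict X)
  have **: "(\<lambda>\<omega>. \<lambda>i\<in>{..n}. X i \<omega>) \<in> past M X n \<rightarrow>\<^sub>M (\<Pi>\<^sub>M i\<in>{..n}. half_line)"
    unfolding past_def by (rule measurable_vimage_algebra1) (use measurable_space[OF *] in auto)
  show "subalgebra M (past M X n)"
    unfolding subalgebra_def
  proof (intro conjI)
    show "space (past M X n) = space M" by (simp add: past_def)
    show "sets (past M X n) \<subseteq> sets M"
      using * unfolding past_def
      by (subst sets_vimage_algebra2) (auto dest: measurable_space measurable_sets)
  qed
  have "stopped n \<in> (\<Pi>\<^sub>M i\<in>{..n}. half_line) \<rightarrow>\<^sub>M paths"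
    unfolding stopped_def
  proof (rule measurable_PiM_single')
    show "(\<lambda>\<omega>. if i \<le> n then \<omega> i else 0) \<in> (\<Pi>\<^sub>M i\<in>{..n}. half_line) \<rightarrow>\<^sub>M half_line" for i
      by (cases "i \<le> n") (auto intro: measurable_component_singleton)
  qed (auto simp: space_PiM PiE_iff)
  from measurable_compose[OF ** this]
  show "(\<lambda>\<omega>. stopped n (\<lambda>i. X i \<omega>)) \<in> past M X n \<rightarrow>\<^sub>M paths"
    by (rule measurable_cong[THEN iffD1, rotated]) (auto simp: stopped_def)
qed

subsection \<open>The Markov property\<close>

text \<open>The chain is defined by conditional probabilities of single events for the next state.
  On rectangles these determine the joint law of history and next state, and uniqueness of measures
  on an intersection-stable generator extends the identity to all bounded measurable
  integrands.\<close>

lemma markov_step: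
  fixes F :: "(nat \<Rightarrow> real) \<Rightarrow> real"
  assumes K: "K \<in> half_line \<rightarrow>\<^sub>M prob_algebra half_line"
    and mc: "markov_chain_from K x M X"
    and F: "F \<in> borel_measurable paths"
    and B: "\<And>\<omega>. \<omega> \<in> space paths \<Longrightarrow> \<bar>F \<omega>\<bar> \<le> B"
  shows "(\<integral>\<omega>. F (stopped (Suc n) (\<lambda>i. X i \<omega>)) \<partial>M)
       = (\<integral>\<omega>. (\<integral>y. F (fun_upd (stopped n (\<lambda>i. X i \<omega>)) (Suc n) y) \<partial>K (X n \<omega>)) \<partial>M)"
proof -
  interpret M: prob_space M using mc by (simp add: markov_chain_from_def)
  have X: "\<And>n. X n \<in> M \<rightarrow>\<^sub>M half_line" using mc by (simp add: markov_chain_from_def)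
  note [measurable] = X
  interpret finite_measure_subalgebra M "past M X n"
    by unfold_locales (rule past_facts[OF X])
  define Z where "Z = (\<lambda>\<omega>. stopped n (\<lambda>i. X i \<omega>))"
  have Zp: "Z \<in> past M X n \<rightarrow>\<^sub>M paths" unfolding Z_def by (rule past_facts[OF X])
  have ZM [measurable]: "Z \<in> M \<rightarrow>\<^sub>M paths" by (rule measurable_from_subalg[OF subalg Zp])
  have KX: "(\<lambda>\<omega>. K (X n \<omega>)) \<in> M \<rightarrow>\<^sub>M prob_algebra half_line"
    by (rule measurable_compose[OF X K])
  \<comment> \<open>\<open>L \<omega>\<close> is the product of the point mass at the history
    \<open>Z \<omega>\<close> with the transition law from \<open>X n \<omega>\<close>; the claim
    \<open>law\<close> says that it disintegrates the joint law.\<close>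
  define L where "L = (\<lambda>\<omega>. distr (K (X n \<omega>)) (paths \<Otimes>\<^sub>M half_line) (Pair (Z \<omega>)))"
  have L: "L \<in> M \<rightarrow>\<^sub>M prob_algebra (paths \<Otimes>\<^sub>M half_line)"
    unfolding L_def by (rule measurable_distr_prob_space2[OF KX]) measurable
  have Ls: "L \<in> M \<rightarrow>\<^sub>M subprob_algebra (paths \<Otimes>\<^sub>M half_line)"
    by (rule measurable_prob_algebraD[OF L])
  have K1: "0 \<le> X n \<omega>" if "\<omega> \<in> space M" for \<omega>
    using measurable_space[OF X that] by simp
  have Pm: "Pair (Z \<omega>) \<in> K (X n \<omega>) \<rightarrow>\<^sub>M paths \<Otimes>\<^sub>M half_line" if "\<omega> \<in> space M" for \<omega>
    using kernel_prob_space(2)[OF K K1[OF that]] measurable_space[OF ZM that]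
    by (auto cong: measurable_cong_sets)
  have law: "distr M (paths \<Otimes>\<^sub>M half_line) (\<lambda>\<omega>. (Z \<omega>, X (Suc n) \<omega>)) = M \<bind> L"
  proof (rule measure_eqI_generator_eq[OF Int_stable_pair_measure_generator[of paths half_line]])
    show "{a \<times> b |a b. a \<in> sets paths \<and> b \<in> sets half_line} \<subseteq> Pow (space (paths \<Otimes>\<^sub>M half_line))"
      using sets.space_closed[of paths] sets.space_closed[of half_line]
      by (auto simp: space_pair_measure simp del: space_half_line)
    show "sets (distr M (paths \<Otimes>\<^sub>M half_line) (\<lambda>\<omega>. (Z \<omega>, X (Suc n) \<omega>)))
        = sigma_sets (space (paths \<Otimes>\<^sub>M half_line)) {a \<times> b |a b. a \<in> sets paths \<and> b \<in> sets half_line}"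
      by (simp only: sets_distr sets_pair_measure space_pair_measure)
    have "sets (M \<bind> L) = sets (paths \<Otimes>\<^sub>M half_line)"
      by (rule sets_bind[OF _ M.not_empty]) (simp add: L_def)
    then show "sets (M \<bind> L)
        = sigma_sets (space (paths \<Otimes>\<^sub>M half_line)) {a \<times> b |a b. a \<in> sets paths \<and> b \<in> sets half_line}"
      by (simp only: sets_pair_measure space_pair_measure)
    show "range (\<lambda>_::nat. space paths \<times> space half_line)
        \<subseteq> {a \<times> b |a b. a \<in> sets paths \<and> b \<in> sets half_line}" by (auto simp del: space_half_line)
    show "(\<Union>i::nat. space paths \<times> space half_line) = space (paths \<Otimes>\<^sub>M half_line)"
      by (simp add: space_pair_measure)
    show "emeasure (distr M (paths \<Otimes>\<^sub>M half_line) (\<lambda>\<omega>. (Z \<omega>, X (Suc n) \<omega>)))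
        (space paths \<times> space half_line) \<noteq> \<infinity>" for i :: nat
      by (subst emeasure_distr) (auto simp del: space_half_line)
  next
    fix R assume "R \<in> {a \<times> b |a b. a \<in> sets paths \<and> b \<in> sets half_line}"
    then obtain A C where R: "R = A \<times> C" and A [measurable]: "A \<in> sets paths"
      and C [measurable]: "C \<in> sets half_line" by auto
    let ?A = "\<lambda>\<omega>. indicator A (Z \<omega>) :: real" and ?C = "\<lambda>\<omega>. indicator C (X (Suc n) \<omega>) :: real"
    have Ap: "?A \<in> borel_measurable (past M X n)"
      by (rule measurable_compose[OF Zp]) measurable
    have AM [measurable]: "?A \<in> borel_measurable M" and CM [measurable]: "?C \<in> borel_measurable M"
      by measurable
    have Kb [measurable]: "(\<lambda>\<omega>. measure (K (X n \<omega>)) C) \<in> borel_measurable M"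
      by (rule measurable_compose[OF measurable_prob_algebraD[OF KX]]) measurable
    have AE: "AE \<omega> in M. real_cond_exp M (past M X n) ?C \<omega> = measure (K (X n \<omega>)) C"
      using mc C by (simp add: markov_chain_from_def)
    have int: "integrable M (\<lambda>\<omega>. ?A \<omega> * ?C \<omega>)"
      by (rule M.integrable_const_bound[where B = 1]) (auto simp: indicator_def)
    have int2: "integrable M (\<lambda>\<omega>. ?A \<omega> * measure (K (X n \<omega>)) C)"
      by (rule M.integrable_const_bound[where B = 1])
         (auto simp: indicator_def intro!: AE_I2 prob_space.prob_le_1 kernel_prob_space[OF K] K1)
    have Rs [measurable]: "R \<in> sets (paths \<Otimes>\<^sub>M half_line)"
      unfolding R by measurable
    have "measure (distr M (paths \<Otimes>\<^sub>M half_line) (\<lambda>\<omega>. (Z \<omega>, X (Suc n) \<omega>))) R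
        = (\<integral>z. indicator R z \<partial>distr M (paths \<Otimes>\<^sub>M half_line) (\<lambda>\<omega>. (Z \<omega>, X (Suc n) \<omega>)))"
      using sets.sets_into_space[OF Rs] by (simp add: Int_absorb2)
    also have "\<dots> = (\<integral>\<omega>. indicator R (Z \<omega>, X (Suc n) \<omega>) \<partial>M)"
      by (rule integral_distr) measurable
    also have "\<dots> = (\<integral>\<omega>. ?A \<omega> * ?C \<omega> \<partial>M)"
      by (simp add: R indicator_times)
    \<comment> \<open>The event \<open>A\<close> concerns the history, so \<open>?A\<close> is
      measurable for the past and \<open>?C\<close> may be replaced by its conditional
      expectation.\<close>
    also have "\<dots> = (\<integral>\<omega>. ?A \<omega> * real_cond_exp M (past M X n) ?C \<omega> \<partial>M)"
      by (rule real_cond_exp_intg(2)[OF int Ap CM, symmetric])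
    also have "\<dots> = (\<integral>\<omega>. ?A \<omega> * measure (K (X n \<omega>)) C \<partial>M)"
      by (rule integral_cong_AE) (use AE in auto)
    finally have 1: "measure (distr M (paths \<Otimes>\<^sub>M half_line) (\<lambda>\<omega>. (Z \<omega>, X (Suc n) \<omega>))) R
        = (\<integral>\<omega>. ?A \<omega> * measure (K (X n \<omega>)) C \<partial>M)" .
    have "emeasure (M \<bind> L) R = (\<integral>\<^sup>+\<omega>. emeasure (L \<omega>) R \<partial>M)"
      unfolding R by (rule emeasure_bind[OF M.not_empty Ls]) measurable
    also have "\<dots> = (\<integral>\<^sup>+\<omega>. ennreal (?A \<omega> * measure (K (X n \<omega>)) C) \<partial>M)"
    proof (rule nn_integral_cong)
      fix \<omega> assume \<omega>: "\<omega> \<in> space M"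
      interpret Kp: prob_space "K (X n \<omega>)" by (rule kernel_prob_space[OF K K1[OF \<omega>]])
      have "Pair (Z \<omega>) -` R \<inter> space (K (X n \<omega>)) = (if Z \<omega> \<in> A then C else {})"
        using kernel_prob_space(3)[OF K K1[OF \<omega>]] sets.sets_into_space[OF C] by (auto simp: R)
      then show "emeasure (L \<omega>) R = ennreal (?A \<omega> * measure (K (X n \<omega>)) C)"
        unfolding L_def by (subst emeasure_distr[OF Pm[OF \<omega>]]) (auto simp: R Kp.emeasure_eq_measure)
    qed
    also have "\<dots> = ennreal (\<integral>\<omega>. ?A \<omega> * measure (K (X n \<omega>)) C \<partial>M)"
      by (rule nn_integral_eq_integral[OF int2]) auto
    finally have 2: "emeasure (M \<bind> L) R = ennreal (\<integral>\<omega>. ?A \<omega> * measure (K (X n \<omega>)) C \<partial>M)" .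
    interpret D: prob_space "distr M (paths \<Otimes>\<^sub>M half_line) (\<lambda>\<omega>. (Z \<omega>, X (Suc n) \<omega>))"
      by (rule M.prob_space_distr) measurable
    show "emeasure (distr M (paths \<Otimes>\<^sub>M half_line) (\<lambda>\<omega>. (Z \<omega>, X (Suc n) \<omega>))) R = emeasure (M \<bind> L) R"
      by (simp only: D.emeasure_eq_measure 1 2)
  qed
  have Lp: "prob_space (L \<omega>)" if "\<omega> \<in> space M" for \<omega>
    using measurable_space[OF L that] by (simp add: space_prob_algebra)
  let ?F = "\<lambda>(\<omega>, y). F (fun_upd \<omega> (Suc n) y)"
  have F2 [measurable]: "?F \<in> borel_measurable (paths \<Otimes>\<^sub>M half_line)"
    unfolding split_beta' by (rule measurable_compose[OF fun_upd_paths F])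
  have "(\<integral>z. ?F z \<partial>distr M (paths \<Otimes>\<^sub>M half_line) (\<lambda>\<omega>. (Z \<omega>, X (Suc n) \<omega>)))
      = (\<integral>\<omega>. ?F (Z \<omega>, X (Suc n) \<omega>) \<partial>M)"
    by (rule integral_distr[OF _ F2]) measurable
  then have "(\<integral>\<omega>. F (stopped (Suc n) (\<lambda>i. X i \<omega>)) \<partial>M)
      = (\<integral>z. ?F z \<partial>distr M (paths \<Otimes>\<^sub>M half_line) (\<lambda>\<omega>. (Z \<omega>, X (Suc n) \<omega>)))"
    by (simp add: stopped_Suc Z_def)
  also have "\<dots> = (\<integral>\<omega>. (\<integral>z. ?F z \<partial>L \<omega>) \<partial>M)"
    unfolding law
    by (rule integral_bind[OF F2 _ Ls M.finite_measure_axioms, where B = B and B' = 1])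
       (use B in \<open>auto simp: space_pair_measure space_paths intro!: AE_I2 prob_space.emeasure_le_1 Lp\<close>)
  also have "\<dots> = (\<integral>\<omega>. (\<integral>y. F (fun_upd (Z \<omega>) (Suc n) y) \<partial>K (X n \<omega>)) \<partial>M)"
    unfolding L_def
  proof (rule Bochner_Integration.integral_cong[OF refl])
    fix \<omega> assume "\<omega> \<in> space M"
    from integral_distr[OF Pm[OF this] F2]
    show "(\<integral>z. ?F z \<partial>distr (K (X n \<omega>)) (paths \<Otimes>\<^sub>M half_line) (Pair (Z \<omega>)))
        = (\<integral>y. F (fun_upd (Z \<omega>) (Suc n) y) \<partial>K (X n \<omega>))" by simp
  qed
  finally show ?thesis by (simp add: Z_def)
qed

text \<open>The induction hypothesis at \<open>Suc i\<close> integrates out all states after time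
  \<open>i + 1\<close>; \<open>markov_step\<close> then integrates out the state at time
  \<open>i + 1\<close>. This is why \<open>i\<close> is kept arbitrary.\<close>

lemma chain_expectation_iter:
  fixes F :: "(nat \<Rightarrow> real) \<Rightarrow> real"
  assumes K: "K \<in> half_line \<rightarrow>\<^sub>M prob_algebra half_line"
    and mc: "markov_chain_from K x M X"
    and F: "F \<in> borel_measurable paths"
    and B: "\<And>\<omega>. \<omega> \<in> space paths \<Longrightarrow> \<bar>F \<omega>\<bar> \<le> B"
  shows "(\<integral>\<omega>. F (stopped (i + k) (\<lambda>j. X j \<omega>)) \<partial>M)
       = (\<integral>\<omega>. iter_integral K F k i (stopped i (\<lambda>j. X j \<omega>)) \<partial>M)"
proof (induction k arbitrary: i)
  case (Suc k)
  have "0 \<le> B" using B[of "\<lambda>_. 0"] by (simp add: space_paths)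
  then have "(\<integral>\<omega>. iter_integral K F k (Suc i) (stopped (Suc i) (\<lambda>j. X j \<omega>)) \<partial>M)
    = (\<integral>\<omega>. (\<integral>y. iter_integral K F k (Suc i) (fun_upd (stopped i (\<lambda>j. X j \<omega>)) (Suc i) y)
        \<partial>K (X i \<omega>)) \<partial>M)"
    by (intro markov_step[OF K mc iter_integral_measurable[OF K F]])
       (rule iter_integral_bound[OF K], use B in auto)
  with Suc[of "Suc i"] show ?case by (simp add: stopped_def)
qed simp

text \<open>At time 0 the remaining integrand depends on \<open>X 0\<close> alone, which is almost
  surely \<open>x\<close>. The path \<open>stopped 0 (\<lambda>_. x)\<close> is \<open>x\<close>
  followed by zeros, and those up to time \<open>m\<close> are overwritten by the
  transitions.\<close>

lemma chain_expectation:
  fixes F :: "(nat \<Rightarrow> real) \<Rightarrow> real"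
  assumes K: "K \<in> half_line \<rightarrow>\<^sub>M prob_algebra half_line"
    and mc: "markov_chain_from K x M X"
    and F: "F \<in> borel_measurable paths"
    and B: "\<And>\<omega>. \<omega> \<in> space paths \<Longrightarrow> \<bar>F \<omega>\<bar> \<le> B"
  shows "(\<integral>\<omega>. F (stopped m (\<lambda>j. X j \<omega>)) \<partial>M) = iter_integral K F m 0 (stopped 0 (\<lambda>_. x))"
proof -
  interpret M: prob_space M using mc by (simp add: markov_chain_from_def)
  have X: "\<And>n. X n \<in> M \<rightarrow>\<^sub>M half_line" using mc by (simp add: markov_chain_from_def)
  have meas: "(\<lambda>\<omega>. stopped 0 (\<lambda>j. X j \<omega>)) \<in> M \<rightarrow>\<^sub>M paths"
    by (rule measurable_from_subalg[OF past_facts[OF X]])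
  have "AE \<omega> in M. X 0 \<omega> = x" using mc by (simp add: markov_chain_from_def)
  then have AE: "AE \<omega> in M. iter_integral K F m 0 (stopped 0 (\<lambda>j. X j \<omega>))
      = iter_integral K F m 0 (stopped 0 (\<lambda>_. x))"
  proof eventually_elim
    case (elim \<omega>)
    then have "stopped 0 (\<lambda>j. X j \<omega>) = stopped 0 (\<lambda>_. x)" by (auto simp: stopped_def)
    then show ?case by simp
  qed
  have "(\<integral>\<omega>. iter_integral K F m 0 (stopped 0 (\<lambda>j. X j \<omega>)) \<partial>M)
      = (\<integral>\<omega>. iter_integral K F m 0 (stopped 0 (\<lambda>_. x)) \<partial>M)"
    by (rule integral_cong_AE[OF measurable_compose[OF meas iter_integral_measurable[OF K F]] _ AE]) simp
  then show ?thesis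
    using chain_expectation_iter[OF K mc F B, of 0 m] by (simp add: M.prob_space)
qed

subsection \<open>Rescaling and passage to the limit\<close>

text \<open>The transition kernel of the chain \<open>X i / t\<close>: state \<open>v\<close> stands
  for the original state \<open>t * v\<close>.\<close>

definition scaled_kernel :: "(real \<Rightarrow> real measure) \<Rightarrow> real \<Rightarrow> real \<Rightarrow> real measure" where
  "scaled_kernel K t v = distr (K (t * v)) half_line (\<lambda>x. x / t)"

lemma half_line_divide: "0 < t \<Longrightarrow> (\<lambda>x. x / t) \<in> half_line \<rightarrow>\<^sub>M half_line"
  by (rule measurable_half_lineI) (auto intro: borel_measurable_divide)

lemma scaled_kernel_measurable:
  assumes K: "K \<in> half_line \<rightarrow>\<^sub>M prob_algebra half_line" and t: "0 < t"
  shows "scaled_kernel K t \<in> half_line \<rightarrow>\<^sub>M prob_algebra half_line"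
proof -
  have 1: "(\<lambda>v. t * v) \<in> half_line \<rightarrow>\<^sub>M half_line"
    using t by (intro measurable_half_lineI) auto
  have "(\<lambda>v. distr (K (t * v)) half_line (\<lambda>x. x / t)) \<in> half_line \<rightarrow>\<^sub>M prob_algebra half_line"
    by (rule measurable_distr_prob_space2[OF measurable_compose[OF 1 K]])
       (use measurable_compose[OF measurable_snd half_line_divide[OF t]] in \<open>simp add: split_beta'\<close>)
  then show ?thesis by (simp add: scaled_kernel_def[abs_def])
qed

lemma integral_scaled_kernel:
  fixes f :: "real \<Rightarrow> real"
  assumes K: "K \<in> half_line \<rightarrow>\<^sub>M prob_algebra half_line" and t: "0 < t" and v: "0 \<le> v"
    and f: "f \<in> borel_measurable half_line"
  shows "(\<integral>y. f y \<partial>scaled_kernel K t v) = (\<integral>x. f (x / t) \<partial>K (t * v))"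
  unfolding scaled_kernel_def
proof (rule integral_distr[OF _ f])
  have "0 \<le> t * v" using t v by simp
  then show "(\<lambda>x. x / t) \<in> K (t * v) \<rightarrow>\<^sub>M half_line"
    using half_line_divide[OF t] kernel_prob_space(2)[OF K] by (simp cong: measurable_cong_sets)
qed

text \<open>Moves the scaling from the test function into the kernel, so that the limit concerns a
  fixed \<open>F\<close> and a family of kernels. Each transition is one change of
  variables.\<close>

lemma iter_integral_scaled:
  assumes K: "K \<in> half_line \<rightarrow>\<^sub>M prob_algebra half_line" and t: "0 < t"
    and F: "F \<in> borel_measurable paths" and \<omega>: "\<omega> \<in> space paths"
  shows "iter_integral K (\<lambda>\<omega>. F (\<lambda>j. \<omega> j / t)) k i \<omega>
       = iter_integral (scaled_kernel K t) F k i (\<lambda>j. \<omega> j / t)"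
  using \<omega>
proof (induction k arbitrary: i \<omega>)
  case (Suc k)
  have nn: "0 \<le> \<omega> i" using Suc.prems by (simp add: space_paths)
  have \<omega>': "(\<lambda>j. \<omega> j / t) \<in> space paths" using Suc.prems t by (simp add: space_paths)
  let ?f = "\<lambda>y. iter_integral (scaled_kernel K t) F k (Suc i) (fun_upd (\<lambda>j. \<omega> j / t) (Suc i) y)"
  have f: "?f \<in> borel_measurable half_line"
    by (rule measurable_compose[OF fun_upd_paths'[OF \<omega>']
          iter_integral_measurable[OF scaled_kernel_measurable[OF K t] F]])
  have "(\<integral>y. ?f y \<partial>scaled_kernel K t (\<omega> i / t)) = (\<integral>x. ?f (x / t) \<partial>K (\<omega> i))"
    using integral_scaled_kernel[OF K t _ f, of "\<omega> i / t"] nn t by simp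
  also have "\<dots> = (\<integral>x. iter_integral K (\<lambda>\<omega>. F (\<lambda>j. \<omega> j / t)) k (Suc i) (fun_upd \<omega> (Suc i) x) \<partial>K (\<omega> i))"
  proof (rule Bochner_Integration.integral_cong[OF refl])
    fix x assume "x \<in> space (K (\<omega> i))"
    then have "fun_upd \<omega> (Suc i) x \<in> space paths"
      using kernel_prob_space(3)[OF K nn] Suc.prems by (simp add: space_paths)
    from Suc.IH[OF this, of "Suc i"]
    show "?f (x / t) = iter_integral K (\<lambda>\<omega>. F (\<lambda>j. \<omega> j / t)) k (Suc i) (fun_upd \<omega> (Suc i) x)"
      by (simp add: fun_upd_def if_distrib[of "\<lambda>x. x / t"])
  qed
  finally show ?case by simp
qed simp

text \<open>Skorohod's theorem works with laws on the real line, while the domain of attraction is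
  formulated on \<open>[0,\<infinity>]\<close>. As the limit is a probability law on the line, it
  suffices to test with the continuous steps \<open>cts_step a b\<close>, whose restrictions to the
  half-line extend continuously to the compactification.\<close>

lemma domain_of_attraction_weak_conv_m:
  assumes G: "G \<in> space (prob_algebra half_line)"
    and K: "K \<in> half_line \<rightarrow>\<^sub>M prob_algebra half_line"
    and KG: "in_domain_of_attraction K G"
    and s: "filterlim s at_top sequentially" and s0: "\<And>n::nat. 0 \<le> s n"
  shows "weak_conv_m (\<lambda>n. distr (K (s n)) borel (\<lambda>x. x / s n)) (distr G borel (\<lambda>x. x))"
    and "\<And>n. real_distribution (distr (K (s n)) borel (\<lambda>x. x / s n))"
    and "real_distribution (distr G borel (\<lambda>x. x))"
proof -
  have Gs: "sets G = sets half_line" "prob_space G"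
    using G by (auto simp: space_prob_algebra)
  have Gsp: "space G = {0..}" using sets_eq_imp_space_eq[OF Gs(1)] by simp
  note Ks = kernel_prob_space[OF K s0]
  have KM: "f \<in> borel_measurable borel \<Longrightarrow> f \<in> K (s n) \<rightarrow>\<^sub>M borel" for n and f :: "real \<Rightarrow> 'z::topological_space"
    unfolding measurable_cong_sets[OF Ks(2) refl] half_line_def by (rule measurable_restrict_space1)
  have GM: "f \<in> borel_measurable borel \<Longrightarrow> f \<in> G \<rightarrow>\<^sub>M borel" for f :: "real \<Rightarrow> 'z::topological_space"
    unfolding measurable_cong_sets[OF Gs(1) refl] half_line_def by (rule measurable_restrict_space1)
  show R1: "real_distribution (distr (K (s n)) borel (\<lambda>x. x / s n))" for n
    by (intro prob_space.real_distribution_distr Ks KM) measurable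
  show R2: "real_distribution (distr G borel (\<lambda>x. x))"
    by (intro prob_space.real_distribution_distr Gs GM) measurable
  show "weak_conv_m (\<lambda>n. distr (K (s n)) borel (\<lambda>x. x / s n)) (distr G borel (\<lambda>x. x))"
  proof (rule integral_cts_step_conv_imp_weak_conv[OF R1 R2])
    fix a b :: real assume ab: "a < b"
    have cc: "continuous_on UNIV (cts_step a b)"
      by (rule uniformly_continuous_imp_continuous[OF cts_step_uniformly_continuous[OF ab]])
    have [measurable]: "cts_step a b \<in> borel_measurable borel"
      by (rule borel_measurable_continuous_onI[OF cc])
    \<comment> \<open>\<^term>\<open>cts_step a b\<close> vanishes beyond \<open>b\<close>, so truncating there extends it continuously to \<open>\<infinity>\<close>.\<close>
    define \<phi> where "\<phi> = (\<lambda>z. cts_step a b (enn2real (min z (ennreal (max b 0)))))"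
    have fin: "ennreal (enn2real (min z (ennreal (max b 0)))) = min z (ennreal (max b 0))" for z
      by (rule ennreal_enn2real) (simp add: min_less_iff_disj)
    \<comment> \<open>\<open>enn2real\<close> jumps to 0 at infinity, so its continuity is used only
      at the finite values left by the truncation.\<close>
    have "continuous_on UNIV (\<lambda>z. enn2real (min z (ennreal (max b 0))))"
      unfolding continuous_on_def
    proof (intro ballI tendsto_enn2real)
      fix z :: ennreal
      show "((\<lambda>z. min z (ennreal (max b 0))) \<longlongrightarrow> ennreal (enn2real (min z (ennreal (max b 0))))) (at z)"
        unfolding fin by (intro tendsto_min tendsto_ident_at tendsto_const)
    qed simp
    then have cphi: "continuous_on UNIV \<phi>"
      unfolding \<phi>_def by (intro continuous_on_compose2[OF cc]) auto
    have bphi: "bounded (range \<phi>)"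
      unfolding bounded_iff using ab by (intro exI[of _ 1]) (auto simp: \<phi>_def cts_step_def divide_simps)
    have [measurable]: "\<phi> \<in> borel_measurable borel"
      by (rule borel_measurable_continuous_onI[OF cphi])
    have phi: "\<phi> (ennreal r) = cts_step a b r" if "0 \<le> r" for r
      using that ab by (auto simp: \<phi>_def min_def cts_step_def max_def split: if_splits)
    have "((\<lambda>t. \<integral>x. \<phi> x \<partial>distr (K t) borel (\<lambda>x. ennreal (x / t))) \<longlongrightarrow> (\<integral>x. \<phi> x \<partial>distr G borel ennreal)) at_top"
      using KG cphi bphi unfolding in_domain_of_attraction_def weak_conv_on_def by simp
    from filterlim_compose[OF this s]
    have "(\<lambda>n. \<integral>x. \<phi> x \<partial>distr (K (s n)) borel (\<lambda>x. ennreal (x / s n))) \<longlonglongrightarrow> (\<integral>x. \<phi> x \<partial>distr G borel ennreal)" .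
    moreover have "(\<integral>x. \<phi> x \<partial>distr (K (s n)) borel (\<lambda>x. ennreal (x / s n)))
        = (\<integral>x. cts_step a b x \<partial>distr (K (s n)) borel (\<lambda>x. x / s n))" for n
      by (subst (1 2) integral_distr)
         (auto intro!: KM Bochner_Integration.integral_cong phi simp: Ks s0)
    moreover have "(\<integral>x. \<phi> x \<partial>distr G borel ennreal) = (\<integral>x. cts_step a b x \<partial>distr G borel (\<lambda>x. x))"
      by (subst (1 2) integral_distr)
         (auto intro!: GM Bochner_Integration.integral_cong phi simp: Gsp)
    ultimately show "(\<lambda>n. \<integral>x. cts_step a b x \<partial>distr (K (s n)) borel (\<lambda>x. x / s n))
        \<longlonglongrightarrow> (\<integral>x. cts_step a b x \<partial>distr G borel (\<lambda>x. x))" by simp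
  qed
qed

text \<open>An extended continuous mapping theorem: the integrands vary with \<open>n\<close>, and
  their continuous convergence to \<open>h\<close> on the set \<open>S\<close> of full
  \<open>G\<close>-measure is exactly what survives evaluation along Skorohod's pointwise convergent
  variables. The bound \<open>B\<close> is the dominating function.\<close>

lemma kernel_integral_tendsto:
  fixes g :: "nat \<Rightarrow> real \<Rightarrow> real"
  assumes G: "G \<in> space (prob_algebra half_line)"
    and K: "K \<in> half_line \<rightarrow>\<^sub>M prob_algebra half_line"
    and KG: "in_domain_of_attraction K G"
    and s: "filterlim s at_top sequentially" and s0: "\<And>n. 0 \<le> s n"
    and g: "\<And>n. g n \<in> borel_measurable half_line" and h: "h \<in> borel_measurable half_line"
    and B: "\<And>n y. 0 \<le> y \<Longrightarrow> \<bar>g n y\<bar> \<le> B"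
    and S: "S \<in> sets borel" and GS: "AE y in G. y \<in> S"
    and conv: "\<And>y z. 0 \<le> y \<Longrightarrow> y \<in> S \<Longrightarrow> (\<And>n. 0 \<le> z n) \<Longrightarrow> z \<longlonglongrightarrow> y \<Longrightarrow> (\<lambda>n. g n (z n)) \<longlonglongrightarrow> h y"
  shows "(\<lambda>n. \<integral>x. g n (x / s n) \<partial>K (s n)) \<longlonglongrightarrow> (\<integral>y. h y \<partial>G)"
proof -
  have Gs: "sets G = sets half_line" "prob_space G"
    using G by (auto simp: space_prob_algebra)
  have Gsp: "space G = {0..}" using sets_eq_imp_space_eq[OF Gs(1)] by simp
  note Ks = kernel_prob_space[OF K s0]
  have KM: "f \<in> borel_measurable borel \<Longrightarrow> f \<in> borel_measurable (K (s n))" for n and f :: "real \<Rightarrow> real"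
    unfolding measurable_cong_sets[OF Ks(2) refl] half_line_def by (rule measurable_restrict_space1)
  have GM: "f \<in> borel_measurable borel \<Longrightarrow> f \<in> borel_measurable G" for f :: "real \<Rightarrow> real"
    unfolding measurable_cong_sets[OF Gs(1) refl] half_line_def by (rule measurable_restrict_space1)
  \<comment> \<open>Skorohod's variables are nonnegative only almost surely, whereas
    \<open>g n\<close> and \<open>h\<close> are controlled on the half-line. Composing with
    \<open>max 0\<close> extends them to the real line without changing any integral.\<close>
  have mx: "max (0::real) \<in> borel \<rightarrow>\<^sub>M half_line"
    by (rule measurable_half_lineI) auto
  have gm [measurable]: "(\<lambda>x. g n (max 0 x)) \<in> borel_measurable borel" for n
    by (rule measurable_compose[OF mx g])
  have hm [measurable]: "(\<lambda>x. h (max 0 x)) \<in> borel_measurable borel"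
    by (rule measurable_compose[OF mx h])
  note W = domain_of_attraction_weak_conv_m[OF G K KG s s0]
  from Skorohod[OF W(2) W(3) W(1)]
  obtain \<Omega> :: "real measure" and Y :: "nat \<Rightarrow> real \<Rightarrow> real" and Y0 where
    \<Omega>: "prob_space \<Omega>" and Y [measurable]: "\<And>n. Y n \<in> borel_measurable \<Omega>"
    and dY: "\<And>n. distr \<Omega> borel (Y n) = distr (K (s n)) borel (\<lambda>x. x / s n)"
    and Y0': "Y0 \<in> \<Omega> \<rightarrow>\<^sub>M lborel" and dY0: "distr \<Omega> borel Y0 = distr G borel (\<lambda>x. x)"
    and lim: "\<And>x. x \<in> space \<Omega> \<Longrightarrow> (\<lambda>n. Y n x) \<longlonglongrightarrow> Y0 x"
    by blast
  interpret \<Omega>: prob_space \<Omega> by fact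
  have Y0 [measurable]: "Y0 \<in> borel_measurable \<Omega>" using Y0' by simp
  have [measurable]: "S \<in> sets borel" by fact
  have "AE y in distr G borel (\<lambda>x. x). y \<in> S \<and> 0 \<le> y"
    by (subst AE_distr_iff) (use GS in \<open>auto intro: GM simp: Gsp\<close>)
  then have "AE x in \<Omega>. Y0 x \<in> S \<and> 0 \<le> Y0 x"
    unfolding dY0[symmetric] by (subst (asm) AE_distr_iff) auto
  then have AE: "AE x in \<Omega>. (\<lambda>n. g n (max 0 (Y n x))) \<longlonglongrightarrow> h (max 0 (Y0 x))"
  proof (rule AE_mp, intro AE_I2 impI)
    fix x assume x: "x \<in> space \<Omega>" and y: "Y0 x \<in> S \<and> 0 \<le> Y0 x"
    have "(\<lambda>n. max 0 (Y n x)) \<longlonglongrightarrow> max 0 (Y0 x)"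
      by (intro tendsto_intros lim x)
    with y show "(\<lambda>n. g n (max 0 (Y n x))) \<longlonglongrightarrow> h (max 0 (Y0 x))"
      by (intro conv) auto
  qed
  have "(\<lambda>n. \<integral>x. g n (max 0 (Y n x)) \<partial>\<Omega>) \<longlonglongrightarrow> (\<integral>x. h (max 0 (Y0 x)) \<partial>\<Omega>)"
    by (rule integral_dominated_convergence[OF _ _ _ AE, where w = "\<lambda>_. B"]) (auto intro!: B)
  moreover have "(\<integral>x. g n (max 0 (Y n x)) \<partial>\<Omega>) = (\<integral>x. g n (x / s n) \<partial>K (s n))" for n
  proof -
    have "(\<integral>x. g n (max 0 (Y n x)) \<partial>\<Omega>) = (\<integral>x. g n (max 0 x) \<partial>distr \<Omega> borel (Y n))"
      by (rule integral_distr[symmetric]) measurable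
    also have "\<dots> = (\<integral>x. g n (max 0 (x / s n)) \<partial>K (s n))"
      unfolding dY by (rule integral_distr) (auto intro: KM)
    also have "\<dots> = (\<integral>x. g n (x / s n) \<partial>K (s n))"
      by (rule Bochner_Integration.integral_cong) (auto simp: Ks max_absorb2 s0)
    finally show ?thesis .
  qed
  moreover have "(\<integral>x. h (max 0 (Y0 x)) \<partial>\<Omega>) = (\<integral>y. h y \<partial>G)"
  proof -
    have "(\<integral>x. h (max 0 (Y0 x)) \<partial>\<Omega>) = (\<integral>x. h (max 0 x) \<partial>distr \<Omega> borel Y0)"
      by (rule integral_distr[symmetric]) measurable
    also have "\<dots> = (\<integral>x. h (max 0 x) \<partial>G)"
      unfolding dY0 by (rule integral_distr) (auto intro: GM)
    also have "\<dots> = (\<integral>x. h x \<partial>G)"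
      by (rule Bochner_Integration.integral_cong) (auto simp: Gsp max_absorb2)
    finally show ?thesis .
  qed
  ultimately show ?thesis by simp
qed

section \<open>The tail kernel and the limit of iterated integrals\<close>

lemma tail_kernel_measurable:
  assumes G: "G \<in> space (prob_algebra half_line)" and H: "H \<in> space (prob_algebra half_line)"
  shows "tail_kernel G H \<in> half_line \<rightarrow>\<^sub>M prob_algebra half_line"
proof -
  have "(\<lambda>z. fst z * snd z) \<in> half_line \<Otimes>\<^sub>M half_line \<rightarrow>\<^sub>M half_line"
    by (rule measurable_half_lineI)
       (auto simp: space_pair_measure intro!: borel_measurable_times
         measurable_compose[OF measurable_fst half_line_ident] measurable_compose[OF measurable_snd half_line_ident])
  then have "(\<lambda>y. distr G half_line (\<lambda>x. y * x)) \<in> half_line \<rightarrow>\<^sub>M prob_algebra half_line"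
    using G by (intro measurable_distr_prob_space2[where M = half_line] measurable_const) (auto simp: split_beta')
  moreover have "{y \<in> space half_line. 0 < y} \<in> sets half_line"
    by measurable
  ultimately have "(\<lambda>y. if 0 < y then distr G half_line (\<lambda>x. y * x) else H) \<in> half_line \<rightarrow>\<^sub>M prob_algebra half_line"
    using H by (intro measurable_If measurable_const) auto
  then show ?thesis by (simp add: tail_kernel_def[abs_def])
qed

lemma integral_tail_kernel:
  fixes f :: "real \<Rightarrow> real"
  assumes G: "G \<in> space (prob_algebra half_line)" and v: "0 < v"
    and f: "f \<in> borel_measurable half_line"
  shows "(\<integral>y. f y \<partial>tail_kernel G H v) = (\<integral>x. f (v * x) \<partial>G)"
proof -
  have "(\<lambda>x. v * x) \<in> half_line \<rightarrow>\<^sub>M half_line"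
    using v by (intro measurable_half_lineI) auto
  then have "(\<lambda>x. v * x) \<in> G \<rightarrow>\<^sub>M half_line"
    using G by (simp add: space_prob_algebra cong: measurable_cong_sets)
  from integral_distr[OF this f] v show ?thesis by (simp add: tail_kernel_def)
qed

text \<open>Letting the starting paths \<open>z n\<close> vary makes the claim one of continuous
  convergence, which is what \<open>kernel_integral_tendsto\<close> asks of the integrand one step
  earlier. A positive state \<open>\<omega> i\<close> is demanded only while a transition is still
  to come, so the last coordinate may be 0, in accordance with the factor
  \<open>[0,\<infinity>]\<close> of \<open>E' m\<close>. The alternatives in \<open>small\<close>
  handle a zero at an intermediate coordinate.\<close>

lemma iter_integral_tendsto:
  fixes F :: "(nat \<Rightarrow> real) \<Rightarrow> real"
  assumes G: "G \<in> space (prob_algebra half_line)" and H: "H \<in> space (prob_algebra half_line)"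
    and K: "K \<in> half_line \<rightarrow>\<^sub>M prob_algebra half_line"
    and KG: "in_domain_of_attraction K G"
    and t: "filterlim t at_top sequentially" and t0: "\<And>n. 0 < t n"
    and F: "F \<in> borel_measurable paths"
    and B: "\<And>\<omega>. \<omega> \<in> space paths \<Longrightarrow> \<bar>F \<omega>\<bar> \<le> B"
    and cont: "\<And>\<omega> z. \<omega> \<in> space paths \<Longrightarrow> (\<And>n. z n \<in> space paths) \<Longrightarrow>
      (\<And>j. (\<lambda>n. z n j) \<longlonglongrightarrow> \<omega> j) \<Longrightarrow> (\<lambda>n. F (z n)) \<longlonglongrightarrow> F \<omega>"
    and small: "measure G {0} = 0 \<or>
      (\<forall>e>0. \<forall>j\<in>{1..<m}. \<exists>d>0. \<forall>\<omega>\<in>space paths. \<omega> j < d \<longrightarrow> \<bar>F \<omega>\<bar> \<le> e)"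
    and m: "i + k = m"
    and \<omega>: "\<omega> \<in> space paths" and z: "\<And>n. z n \<in> space paths"
    and lim: "\<And>j. (\<lambda>n. z n j) \<longlonglongrightarrow> \<omega> j" and pos: "k \<noteq> 0 \<Longrightarrow> 0 < \<omega> i"
  shows "(\<lambda>n. iter_integral (scaled_kernel K (t n)) F k i (z n)) \<longlonglongrightarrow> iter_integral (tail_kernel G H) F k i \<omega>"
  using m \<omega> z lim pos
proof (induction k arbitrary: i \<omega> z)
  case 0
  then show ?case using cont by simp
next
  case (Suc k)
  define Kt where "Kt n = scaled_kernel K (t n)" for n
  let ?K0 = "tail_kernel G H"
  have Kn: "Kt n \<in> half_line \<rightarrow>\<^sub>M prob_algebra half_line" for n
    unfolding Kt_def by (rule scaled_kernel_measurable[OF K t0])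
  note K0 = tail_kernel_measurable[OF G H]
  define v where "v = (\<lambda>n. z n i)"
  define v0 where "v0 = \<omega> i"
  have v: "v \<longlonglongrightarrow> v0" and v0: "0 < v0" and vn: "0 \<le> v n" for n
    using Suc.prems by (auto simp: v_def v0_def space_paths)
  have B0: "0 \<le> B" using B[OF Suc.prems(2)] by linarith
  have wn: "0 \<le> y \<Longrightarrow> fun_upd (z n) (Suc i) y \<in> space paths" for n y
    using Suc.prems(3) by (simp add: space_paths)
  have w0: "0 \<le> y \<Longrightarrow> fun_upd \<omega> (Suc i) y \<in> space paths" for y
    using Suc.prems(2) by (simp add: space_paths)
  define J where "J n y = iter_integral (Kt n) F k (Suc i) (fun_upd (z n) (Suc i) y)" for n y
  define J0 where "J0 y = iter_integral ?K0 F k (Suc i) (fun_upd \<omega> (Suc i) y)" for y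
  have J: "J n \<in> borel_measurable half_line" for n
    unfolding J_def
    by (rule measurable_compose[OF fun_upd_paths'[OF Suc.prems(3)] iter_integral_measurable[OF Kn F]])
  have J0: "J0 \<in> borel_measurable half_line"
    unfolding J0_def
    by (rule measurable_compose[OF fun_upd_paths'[OF Suc.prems(2)] iter_integral_measurable[OF K0 F]])
  define s where "s n = t n * v n" for n
  have s: "filterlim s at_top sequentially"
    unfolding s_def using filterlim_tendsto_pos_mult_at_top[OF v v0 t] by (simp add: mult.commute)
  have s0: "0 \<le> s n" for n using vn t0[of n] by (simp add: s_def)
  \<comment> \<open>\<open>y = 0\<close> is left out if it is \<open>G\<close>-null, since the induction hypothesis needs a positive state.\<close>
  define S :: "real set" where "S = (if measure G {0} = 0 then {0<..} else UNIV)"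
  have S: "S \<in> sets borel" by (simp add: S_def)
  have AES: "AE y in G. y \<in> S"
  proof (cases "measure G {0} = 0")
    case True
    have Gs: "sets G = sets half_line" and "prob_space G" using G by (auto simp: space_prob_algebra)
    then interpret G: prob_space G by simp
    have "{0} \<in> sets G"
      unfolding Gs half_line_def by (auto simp: sets_restrict_space_iff)
    then have "{0} \<in> null_sets G" using True by (simp add: null_sets_def G.emeasure_eq_measure)
    then show ?thesis
      by (rule AE_I') (use sets_eq_imp_space_eq[OF Gs] True in \<open>auto simp: S_def\<close>)
  qed (simp add: S_def)
  have vm: "(\<lambda>y. c * y) \<in> half_line \<rightarrow>\<^sub>M half_line" if "0 \<le> c" for c :: real
    using that by (intro measurable_half_lineI) auto
  \<comment> \<open>\<open>x / t n = v n * (x / s n)\<close> when \<open>v n > 0\<close>: the scaled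
    next state is the current one times a ratio whose law tends to \<open>G\<close>. The limit
    \<open>v0 * y\<close> is a step of the tail kernel.\<close>
  have L1: "(\<lambda>n. \<integral>x. J n (v n * (x / s n)) \<partial>K (s n)) \<longlonglongrightarrow> (\<integral>y. J0 (v0 * y) \<partial>G)"
  proof (rule kernel_integral_tendsto[OF G K KG s s0 _ _ _ S AES, where B = B])
    show "(\<lambda>y. J n (v n * y)) \<in> borel_measurable half_line" for n
      by (rule measurable_compose[OF vm[OF vn] J])
    show "(\<lambda>y. J0 (v0 * y)) \<in> borel_measurable half_line"
      using v0 by (intro measurable_compose[OF vm J0]) auto
    show "\<bar>J n (v n * y)\<bar> \<le> B" if "0 \<le> y" for n y
      unfolding J_def by (rule iter_integral_bound[OF Kn B0 B]) (use that vn wn in auto)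
  next
    fix y :: real and x :: "nat \<Rightarrow> real"
    assume y: "0 \<le> y" "y \<in> S" and x: "\<And>n. 0 \<le> x n" and xy: "x \<longlonglongrightarrow> y"
    have vx: "(\<lambda>n. v n * x n) \<longlonglongrightarrow> v0 * y" by (intro tendsto_mult v xy)
    show "(\<lambda>n. J n (v n * x n)) \<longlonglongrightarrow> J0 (v0 * y)"
    proof (cases "0 < y \<or> k = 0")
      case True
      show ?thesis unfolding J_def J0_def Kt_def
      proof (rule Suc.IH)
        show "(\<lambda>n. fun_upd (z n) (Suc i) (v n * x n) j) \<longlonglongrightarrow> fun_upd \<omega> (Suc i) (v0 * y) j" for j
          using vx Suc.prems(4) by (cases "j = Suc i") auto
        show "fun_upd \<omega> (Suc i) (v0 * y) \<in> space paths"
          using v0 y by (intro w0) simp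
        show "fun_upd (z n) (Suc i) (v n * x n) \<in> space paths" for n
          using vn x by (intro wn) simp
        show "0 < fun_upd \<omega> (Suc i) (v0 * y) (Suc i)" if "k \<noteq> 0"
          using True that v0 by simp
      qed (use Suc.prems(1) in simp)
    next
      case False
      then have y0: "y = 0" and k: "k \<noteq> 0" using y by auto
      then have "measure G {0} \<noteq> 0" using y by (auto simp: S_def)
      \<comment> \<open>Since \<open>0 \<in> S\<close>, \<open>G\<close> charges 0 and the second
        alternative of \<open>small\<close> holds. It covers the index \<open>Suc i\<close>, which
        is below \<open>m\<close> because \<open>k \<noteq> 0\<close>.\<close>
      with small Suc.prems(1) k have sm: "\<exists>d>0. \<forall>\<omega>\<in>space paths. \<omega> (Suc i) < d \<longrightarrow> \<bar>F \<omega>\<bar> \<le> e"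
        if "0 < e" for e using that by simp
      \<comment> \<open>From state 0 the tail chain moves by the arbitrary law \<open>H\<close>, but
        \<open>F\<close> is at most \<open>e\<close> on every path with a 0 at \<open>Suc i\<close>,
        so \<open>H\<close> cannot influence the value.\<close>
      have J0z: "\<bar>J0 0\<bar> \<le> e" if e: "0 < e" for e
      proof -
        from sm[OF e] obtain d where d: "0 < d" "\<And>\<omega>. \<omega> \<in> space paths \<Longrightarrow> \<omega> (Suc i) < d \<Longrightarrow> \<bar>F \<omega>\<bar> \<le> e"
          by blast
        show ?thesis unfolding J0_def
          by (rule iter_integral_bound[OF K0]) (use d e w0 in auto)
      qed
      have "J0 0 = 0" using field_le_epsilon[of "\<bar>J0 0\<bar>" 0] J0z by auto
      moreover have "(\<lambda>n. J n (v n * x n)) \<longlonglongrightarrow> 0"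
      proof (rule tendstoI)
        fix e :: real assume "0 < e"
        then have e: "0 < e / 2" by simp
        from sm[OF e] obtain d where d: "0 < d" "\<And>\<omega>. \<omega> \<in> space paths \<Longrightarrow> \<omega> (Suc i) < d \<Longrightarrow> \<bar>F \<omega>\<bar> \<le> e / 2"
          by blast
        have "\<forall>\<^sub>F n in sequentially. v n * x n < d"
          using vx d(1) y0 by (intro order_tendstoD(2)) auto
        then show "\<forall>\<^sub>F n in sequentially. dist (J n (v n * x n)) 0 < e"
        proof eventually_elim
          case (elim n)
          have "\<bar>J n (v n * x n)\<bar> \<le> e / 2"
            unfolding J_def by (rule iter_integral_bound[OF Kn]) (use d e wn elim vn x in auto)
          then show ?case using e by (simp add: dist_real_def)
        qed
      qed
      ultimately show ?thesis using y0 by simp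
    qed
  qed
  have L2: "(\<integral>y. J0 (v0 * y) \<partial>G) = iter_integral ?K0 F (Suc k) i \<omega>"
    using integral_tail_kernel[OF G v0 J0] by (simp add: J0_def v0_def)
  \<comment> \<open>This holds only eventually: \<open>v n\<close> may vanish for finitely many
    \<open>n\<close>, and then \<open>x / s n\<close> is 0 by the convention for division and no
    longer a rescaled state.\<close>
  have L3: "\<forall>\<^sub>F n in sequentially. (\<integral>x. J n (v n * (x / s n)) \<partial>K (s n)) = iter_integral (Kt n) F (Suc k) i (z n)"
    using order_tendstoD(1)[OF v v0]
  proof eventually_elim
    case (elim n)
    then have "v n * (x / s n) = x / t n" for x using t0[of n] by (simp add: s_def)
    then show ?case
      using integral_scaled_kernel[OF K t0 vn J, of n n] by (simp add: J_def v_def s_def Kt_def)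
  qed
  show ?case
    using Lim_transform_eventually[OF L1 L3] unfolding L2 Kt_def .
qed

subsection \<open>The compact cube\<close>

lemma space_cube_borel: "space (cube_borel m) = {1..m} \<rightarrow>\<^sub>E UNIV"
  by (simp add: cube_borel_def space_PiM)

lemma topspace_cube_top: "topspace (cube_top m) = {1..m} \<rightarrow>\<^sub>E UNIV"
  by (simp add: cube_top_def)

text \<open>Continuity of the projections gives one inclusion. For the other, an open set of the
  cube is pulled back to the full function space \<open>nat \<Rightarrow> ennreal\<close>, where
  product and Borel sigma-algebras agree by countability.\<close>

lemma sets_cube_borel: "sets (cube_borel m) = sigma_sets (topspace (cube_top m)) {U. openin (cube_top m) U}"
proof
  define S where "S = sigma (topspace (cube_top m)) {U. openin (cube_top m) U}"
  have op: "{U. openin (cube_top m) U} \<subseteq> Pow (topspace (cube_top m))"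
    using openin_subset by auto
  have S: "sets S = sigma_sets (topspace (cube_top m)) {U. openin (cube_top m) U}"
    and Ssp: "space S = topspace (cube_top m)"
    unfolding S_def using op by (simp_all add: sets_measure_of space_measure_of)
  have "(\<lambda>x. \<lambda>i\<in>{1..m}. x i) \<in> S \<rightarrow>\<^sub>M cube_borel m"
    unfolding cube_borel_def
  proof (rule measurable_restrict)
    fix i assume i: "i \<in> {1..m}"
    show "(\<lambda>x. x i) \<in> borel_measurable S"
    proof (rule borel_measurableI)
      fix U :: "ennreal set" assume U: "open U"
      have "openin (cube_top m) {x \<in> topspace (cube_top m). x i \<in> U}"
        using continuous_map_product_projection[OF i, of "\<lambda>_. euclidean :: ennreal topology"] U
        by (intro openin_continuous_map_preimage[where Y = euclidean]) (auto simp: cube_top_def)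
      moreover have "(\<lambda>x. x i) -` U \<inter> space S = {x \<in> topspace (cube_top m). x i \<in> U}"
        by (auto simp: Ssp)
      ultimately show "(\<lambda>x. x i) -` U \<inter> space S \<in> sets S"
        unfolding S by (auto intro: sigma_sets.Basic)
    qed
  qed
  then have id: "(\<lambda>x. x) \<in> S \<rightarrow>\<^sub>M cube_borel m"
  proof (rule measurable_cong[THEN iffD1, rotated])
    fix x assume "x \<in> space S"
    then have "x \<in> extensional {1..m}" unfolding Ssp by (simp add: topspace_cube_top PiE_def)
    then show "(\<lambda>i\<in>{1..m}. x i) = x" by (rule extensional_restrict)
  qed
  show "sets (cube_borel m) \<subseteq> sigma_sets (topspace (cube_top m)) {U. openin (cube_top m) U}"
  proof
    fix A assume A: "A \<in> sets (cube_borel m)"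
    then have "A \<subseteq> space S"
      using sets.sets_into_space[OF A] by (simp add: Ssp topspace_cube_top space_cube_borel)
    with measurable_sets[OF id A] show "A \<in> sigma_sets (topspace (cube_top m)) {U. openin (cube_top m) U}"
      by (simp add: S Int_absorb2)
  qed
  have "{U. openin (cube_top m) U} \<subseteq> sets (cube_borel m)"
  proof safe
    fix U assume U: "openin (cube_top m) U"
    have "continuous_map euclidean (cube_top m) (\<lambda>x::nat \<Rightarrow> ennreal. \<lambda>i\<in>{1..m}. x i)"
      unfolding cube_top_def
      by (subst continuous_map_componentwise) (auto intro!: continuous_on_product_coordinates)
    from openin_continuous_map_preimage[OF this U]
    have "open {x. (\<lambda>i\<in>{1..m}. x i) \<in> U}" by simp
    then have "{x. (\<lambda>i\<in>{1..m}. x i) \<in> U} \<in> sets (\<Pi>\<^sub>M i\<in>UNIV. borel)"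
      by (simp add: sets_PiM_equal_borel)
    \<comment> \<open>Padding by 0 is a measurable right inverse of restriction to
      \<open>{1..m}\<close>; it carries measurability from the full function space back to the
      cube.\<close>
    moreover have "(\<lambda>x j. if j \<in> {1..m} then x j else 0) \<in> cube_borel m \<rightarrow>\<^sub>M (\<Pi>\<^sub>M i\<in>UNIV. borel)"
    proof (rule measurable_PiM_single')
      show "(\<lambda>x. if j \<in> {1..m} then x j else 0) \<in> borel_measurable (cube_borel m)" for j
        unfolding cube_borel_def by (cases "j \<in> {1..m}") (simp_all del: atLeastAtMost_iff)
    qed auto
    ultimately have "(\<lambda>x j. if j \<in> {1..m} then x j else 0) -` {x. (\<lambda>i\<in>{1..m}. x i) \<in> U} \<inter> space (cube_borel m)
        \<in> sets (cube_borel m)" by (rule measurable_sets[rotated])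
    moreover have "(\<lambda>i\<in>{1..m}. if i \<in> {1..m} then x i else 0) = x" if "x \<in> space (cube_borel m)" for x :: "nat \<Rightarrow> ennreal"
      using that by (auto simp: space_cube_borel PiE_def extensional_def fun_eq_iff)
    ultimately show "U \<in> sets (cube_borel m)"
      using openin_subset[OF U]
      by (auto simp: topspace_cube_top space_cube_borel vimage_def Int_def conj_commute cong: conj_cong
          elim!: back_subst[of "\<lambda>A. A \<in> sets (cube_borel m)"])
  qed
  then show "sigma_sets (topspace (cube_top m)) {U. openin (cube_top m) U} \<subseteq> sets (cube_borel m)"
    using sets.top[of "cube_borel m"]
    by (intro sets.sigma_sets_subset') (simp_all add: topspace_cube_top space_cube_borel)
qed

lemma cube_continuous_measurable:
  assumes f: "continuous_map (cube_top m) euclideanreal f"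
  shows "f \<in> borel_measurable (cube_borel m)"
proof (rule borel_measurableI)
  fix U :: "real set" assume "open U"
  then have "openin (cube_top m) {x \<in> topspace (cube_top m). f x \<in> U}"
    using f by (intro openin_continuous_map_preimage) auto
  moreover have "f -` U \<inter> space (cube_borel m) = {x \<in> topspace (cube_top m). f x \<in> U}"
    by (auto simp: topspace_cube_top space_cube_borel)
  ultimately show "f -` U \<inter> space (cube_borel m) \<in> sets (cube_borel m)"
    unfolding sets_cube_borel by (auto intro: sigma_sets.Basic)
qed

lemma compact_space_cube_top: "compact_space (cube_top m)"
  unfolding cube_top_def compact_space_product_topology
  using compact_UNIV by (auto simp: compact_space_def)

lemma Hausdorff_space_cube_top: "Hausdorff_space (cube_top m)"
proof -
  have "Hausdorff_space (euclidean :: ennreal topology)"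
    unfolding Hausdorff_space_def disjnt_def using hausdorff by simp blast
  then show ?thesis
    unfolding cube_top_def Hausdorff_space_product_topology by blast
qed

lemma openin_E': "openin (cube_top m) (E' m)"
proof -
  have "openin (cube_top m) {x \<in> topspace (cube_top m). x i \<in> {0<..}}" if "i \<in> {1..m}" for i
    using continuous_map_product_projection[OF that, of "\<lambda>_. euclidean :: ennreal topology"]
    by (intro openin_continuous_map_preimage[where Y = euclidean]) (auto simp: cube_top_def)
  then have "openin (cube_top m) ((\<Inter>i\<in>{1..<m}. {x \<in> topspace (cube_top m). x i \<in> {0<..}}) \<inter> topspace (cube_top m))"
    by (intro openin_INT) auto
  also have "(\<Inter>i\<in>{1..<m}. {x \<in> topspace (cube_top m). x i \<in> {0<..}}) \<inter> topspace (cube_top m) = E' m"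
    by (auto simp: E'_def topspace_cube_top)
  finally show ?thesis .
qed

lemma cube_function_bounded:
  assumes f: "continuous_map (cube_top m) euclideanreal f"
  obtains B where "\<And>x. x \<in> topspace (cube_top m) \<Longrightarrow> \<bar>f x\<bar> \<le> B"
proof -
  have "compact (f ` topspace (cube_top m))"
    using image_compactin[OF _ f] compact_space_cube_top[of m] by (simp add: compact_space_def)
  then have "bounded (f ` topspace (cube_top m))" by (rule compact_imp_bounded)
  then show ?thesis using that by (auto simp: bounded_iff)
qed

text \<open>The set where \<open>\<bar>f\<bar> \<ge> e\<close> is compact and lies in
  \<open>E' m\<close>. If it is nonempty, coordinate \<open>j\<close> attains a positive minimum on
  it, and below this minimum \<open>\<bar>f\<bar> < e\<close>.\<close>

lemma cube_function_small_near_zero: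
  assumes f: "continuous_map (cube_top m) euclideanreal f"
    and f0: "\<And>x. x \<in> topspace (cube_top m) \<Longrightarrow> x \<notin> E' m \<Longrightarrow> f x = 0"
    and e: "0 < e" and j: "j \<in> {1..<m}"
  shows "\<exists>d>0. \<forall>x\<in>topspace (cube_top m). x j < ennreal d \<longrightarrow> \<bar>f x\<bar> \<le> e"
proof -
  let ?C = "{x \<in> topspace (cube_top m). f x \<in> - {-e<..<e}}"
  have "closedin (cube_top m) ?C"
    using f by (intro closedin_continuous_map_preimage[where Y = euclideanreal]) (auto simp: closed_Compl)
  then have "compactin (cube_top m) ?C"
    using compact_space_cube_top closedin_compact_space by blast
  then have cj: "compact ((\<lambda>x. x j) ` ?C)"
    using image_compactin[where X = "cube_top m" and Y = euclidean and f = "\<lambda>x. x j" and S = ?C]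
      continuous_map_product_projection[of j "{1..m}" "\<lambda>_. euclidean :: ennreal topology"] j
    by (auto simp: cube_top_def)
  show ?thesis
  proof (cases "?C = {}")
    case True
    have "\<bar>f x\<bar> \<le> e" if "x \<in> topspace (cube_top m)" for x
    proof (rule ccontr)
      assume "\<not> \<bar>f x\<bar> \<le> e"
      then have "x \<in> ?C" using that by auto
      with True show False by blast
    qed
    then show ?thesis by (intro exI[of _ 1]) simp
  next
    case False
    then obtain x0 where x0: "x0 \<in> ?C" "\<And>x. x \<in> ?C \<Longrightarrow> x0 j \<le> x j"
      using compact_attains_inf[OF cj] by auto
    have "x0 \<in> E' m"
    proof (rule ccontr)
      assume "x0 \<notin> E' m"
      with f0[of x0] x0(1) e show False by simp
    qed
    then have p: "0 < x0 j" using j by (auto simp: E'_def)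
    \<comment> \<open>The minimum may be infinite; capping it at 1 yields a real number.\<close>
    define d where "d = enn2real (min (x0 j) 1)"
    have ed: "ennreal d = min (x0 j) 1"
      unfolding d_def by (rule ennreal_enn2real) (simp add: min_less_iff_disj)
    have "0 < ennreal d" unfolding ed using p by simp
    then have "0 < d" by simp
    moreover have "\<bar>f x\<bar> \<le> e" if "x \<in> topspace (cube_top m)" "x j < ennreal d" for x
    proof (rule ccontr)
      assume "\<not> \<bar>f x\<bar> \<le> e"
      then have "x \<in> ?C" using that by auto
      from x0(2)[OF this] that(2) show False unfolding ed by (auto dest: leD)
    qed
    ultimately show ?thesis by blast
  qed
qed

subsection \<open>Convergence of the finite-dimensional laws\<close>

lemma cube_path_measurable: "(\<lambda>\<omega>. \<lambda>i\<in>{1..m}. ennreal (\<omega> i)) \<in> paths \<rightarrow>\<^sub>M cube_borel m"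
  unfolding cube_borel_def
  by (intro measurable_restrict measurable_compose[OF _ measurable_ennreal]
      measurable_half_lineD[OF path_component])

lemma cube_path_topspace: "(\<lambda>i\<in>{1..m}. ennreal (\<omega> i)) \<in> topspace (cube_top m)"
  by (simp add: topspace_cube_top)

lemma cube_path_tendsto:
  assumes f: "continuous_map (cube_top m) euclideanreal f"
    and lim: "\<And>j. (\<lambda>n. z n j) \<longlonglongrightarrow> \<omega> j"
  shows "(\<lambda>n. f (\<lambda>i\<in>{1..m}. ennreal (z n i))) \<longlonglongrightarrow> f (\<lambda>i\<in>{1..m}. ennreal (\<omega> i))"
proof -
  have "limitin (cube_top m) (\<lambda>n. \<lambda>i\<in>{1..m}. ennreal (z n i)) (\<lambda>i\<in>{1..m}. ennreal (\<omega> i)) sequentially"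
    unfolding cube_top_def limitin_componentwise using lim by (auto intro!: tendsto_ennrealI)
  from continuous_map_limit[OF f this] show ?thesis by (simp add: o_def)
qed

lemma chain_cube_measurable:
  assumes mc: "markov_chain_from K x M X"
  shows "(\<lambda>\<omega>. \<lambda>i\<in>{1..m}. ennreal (X i \<omega> / t)) \<in> M \<rightarrow>\<^sub>M cube_borel m"
proof -
  have "X n \<in> borel_measurable M" for n
    using mc by (intro measurable_half_lineD) (simp add: markov_chain_from_def)
  then show ?thesis
    unfolding cube_borel_def
    by (intro measurable_restrict measurable_compose[OF _ measurable_ennreal] borel_measurable_divide) simp_all
qed

lemma chain_cube_expectation:
  assumes K: "K \<in> half_line \<rightarrow>\<^sub>M prob_algebra half_line"
    and mc: "markov_chain_from K x M X" and t: "0 < t" and x: "0 \<le> x"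
    and f: "continuous_map (cube_top m) euclideanreal f"
  shows "(\<integral>z. f z \<partial>distr M (cube_borel m) (\<lambda>\<omega>. \<lambda>i\<in>{1..m}. ennreal (X i \<omega> / t)))
    = iter_integral (scaled_kernel K t) (\<lambda>\<omega>. f (\<lambda>i\<in>{1..m}. ennreal (\<omega> i))) m 0 (stopped 0 (\<lambda>_. x / t))"
proof -
  note fm = cube_continuous_measurable[OF f]
  define F where "F = (\<lambda>\<omega>. f (\<lambda>i\<in>{1..m}. ennreal (\<omega> i)))"
  have F: "F \<in> borel_measurable paths"
    unfolding F_def by (rule measurable_compose[OF cube_path_measurable fm])
  obtain B where B: "\<And>x. x \<in> topspace (cube_top m) \<Longrightarrow> \<bar>f x\<bar> \<le> B"
    using cube_function_bounded[OF f] by blast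
  have FB: "\<bar>F \<omega>\<bar> \<le> B" for \<omega>
    unfolding F_def by (rule B[OF cube_path_topspace])
  have "(\<lambda>\<omega> j. \<omega> j / t) \<in> paths \<rightarrow>\<^sub>M paths"
  proof (rule measurable_PiM_single')
    show "(\<lambda>\<omega>. \<omega> j / t) \<in> paths \<rightarrow>\<^sub>M half_line" for j
      by (rule measurable_compose[OF path_component half_line_divide[OF t]])
  qed (use t in \<open>auto simp: space_PiM PiE_iff\<close>)
  then have Ft: "(\<lambda>\<omega>. F (\<lambda>j. \<omega> j / t)) \<in> borel_measurable paths"
    by (rule measurable_compose[OF _ F])
  have "(\<integral>z. f z \<partial>distr M (cube_borel m) (\<lambda>\<omega>. \<lambda>i\<in>{1..m}. ennreal (X i \<omega> / t)))
      = (\<integral>\<omega>. f (\<lambda>i\<in>{1..m}. ennreal (X i \<omega> / t)) \<partial>M)"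
    by (rule integral_distr[OF chain_cube_measurable[OF mc] fm])
  \<comment> \<open>Stopping at time \<open>m\<close> is harmless because \<open>f\<close> reads the
    coordinates 1 to \<open>m\<close> only.\<close>
  also have "\<dots> = (\<integral>\<omega>. F (\<lambda>j. stopped m (\<lambda>j. X j \<omega>) j / t) \<partial>M)"
    unfolding F_def by (auto simp: stopped_def intro!: Bochner_Integration.integral_cong arg_cong[where f = f])
  also have "\<dots> = iter_integral K (\<lambda>\<omega>. F (\<lambda>j. \<omega> j / t)) m 0 (stopped 0 (\<lambda>_. x))"
    by (rule chain_expectation[OF K mc Ft FB])
  also have "\<dots> = iter_integral (scaled_kernel K t) F m 0 (\<lambda>j. stopped 0 (\<lambda>_. x) j / t)"
    using x by (intro iter_integral_scaled[OF K t F]) (simp add: space_paths stopped_def)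
  also have "(\<lambda>j. stopped 0 (\<lambda>_. x) j / t) = stopped 0 (\<lambda>_. x / t)"
    by (auto simp: stopped_def)
  finally show ?thesis unfolding F_def .
qed

lemma scaled_kernel_1:
  assumes K: "K \<in> half_line \<rightarrow>\<^sub>M prob_algebra half_line" and v: "0 \<le> v"
  shows "scaled_kernel K 1 v = K v"
  unfolding scaled_kernel_def using kernel_prob_space(2)[OF K v] by (simp add: distr_id2)

text \<open>The tail chain is treated as a chain rescaled by 1. Its kernel and the kernel scaled by
  1 are known to agree at nonnegative states, the only ones that the iterated integral
  visits.\<close>

lemma iter_integral_cong_kernel:
  assumes KL: "\<And>v. 0 \<le> v \<Longrightarrow> K v = L v" and K: "K \<in> half_line \<rightarrow>\<^sub>M prob_algebra half_line"
    and \<omega>: "\<omega> \<in> space paths"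
  shows "iter_integral K F k i \<omega> = iter_integral L F k i \<omega>"
  using \<omega>
proof (induction k arbitrary: i \<omega>)
  case (Suc k)
  have nn: "0 \<le> \<omega> i" using Suc.prems by (simp add: space_paths)
  have "(\<integral>y. iter_integral K F k (Suc i) (fun_upd \<omega> (Suc i) y) \<partial>K (\<omega> i))
      = (\<integral>y. iter_integral L F k (Suc i) (fun_upd \<omega> (Suc i) y) \<partial>K (\<omega> i))"
    by (rule Bochner_Integration.integral_cong[OF refl], rule Suc.IH)
       (use kernel_prob_space(3)[OF K nn] Suc.prems in \<open>simp add: space_paths\<close>)
  then show ?case by (simp add: KL[OF nn])
qed simp

text \<open>The common core of both convergence claims: \<open>f0\<close> holds for every
  \<open>f\<close> if \<open>G\<close> has no atom at 0, and otherwise it restricts to test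
  functions living on \<open>E' m\<close>.\<close>

lemma cube_integral_tendsto:
  fixes f :: "(nat \<Rightarrow> ennreal) \<Rightarrow> real"
  assumes G: "G \<in> space (prob_algebra half_line)"
    and H: "H \<in> space (prob_algebra half_line)"
    and K: "K \<in> half_line \<rightarrow>\<^sub>M prob_algebra half_line"
    and KG: "in_domain_of_attraction K G"
    and X: "\<And>x. x \<ge> 0 \<Longrightarrow> markov_chain_from K x (P x) X"
    and T: "\<And>x. x \<ge> 0 \<Longrightarrow> markov_chain_from (tail_kernel G H) x (Q x) T"
    and u_nonneg: "\<And>t. t > 0 \<Longrightarrow> u t \<ge> 0"
    and u_lim: "(u \<longlongrightarrow> u0) at_top"
    and u0: "u0 > 0"
    and f: "continuous_map (cube_top m) euclideanreal f"
    and f0: "measure G {0} = 0 \<or> (\<forall>x\<in>topspace (cube_top m) - E' m. f x = 0)"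
  shows "((\<lambda>t. \<integral>x. f x \<partial>pi_scaled P X m t (u t)) \<longlongrightarrow> (\<integral>x. f x \<partial>pi_tail Q T m u0)) at_top"
proof (rule tendsto_at_topI_sequentially)
  fix \<tau> :: "nat \<Rightarrow> real" assume \<tau>: "filterlim \<tau> at_top sequentially"
  \<comment> \<open>Along a sequence Skorohod's theorem applies. The cut-off at 1 makes every
    \<open>t n\<close> positive and is inactive for large \<open>n\<close>, so the limit is
    unaffected.\<close>
  define t where "t n = max (\<tau> n) 1" for n
  have t: "filterlim t at_top sequentially"
    by (rule filterlim_at_top_mono[OF \<tau>]) (simp add: t_def)
  have t0: "0 < t n" for n by (simp add: t_def)
  have ut: "(\<lambda>n. u (t n)) \<longlonglongrightarrow> u0" by (rule filterlim_compose[OF u_lim t])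
  note K0 = tail_kernel_measurable[OF G H]
  define F where "F = (\<lambda>\<omega>. f (\<lambda>i\<in>{1..m}. ennreal (\<omega> i)))"
  have F: "F \<in> borel_measurable paths"
    unfolding F_def by (rule measurable_compose[OF cube_path_measurable cube_continuous_measurable[OF f]])
  obtain B where B: "\<And>x. x \<in> topspace (cube_top m) \<Longrightarrow> \<bar>f x\<bar> \<le> B"
    using cube_function_bounded[OF f] by blast
  have FB: "\<bar>F \<omega>\<bar> \<le> B" for \<omega>
    unfolding F_def by (rule B[OF cube_path_topspace])
  have small: "measure G {0} = 0 \<or>
      (\<forall>e>0. \<forall>j\<in>{1..<m}. \<exists>d>0. \<forall>\<omega>\<in>space paths. \<omega> j < d \<longrightarrow> \<bar>F \<omega>\<bar> \<le> e)"
  proof (rule disj_imp[THEN iffD2], intro allI impI ballI)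
    fix e :: real and j assume G0: "measure G {0} \<noteq> 0" and e: "0 < e" and j: "j \<in> {1..<m}"
    from G0 f0 have "\<And>x. x \<in> topspace (cube_top m) \<Longrightarrow> x \<notin> E' m \<Longrightarrow> f x = 0" by auto
    from cube_function_small_near_zero[OF f this e j]
    obtain d where d: "0 < d" "\<And>x. x \<in> topspace (cube_top m) \<Longrightarrow> x j < ennreal d \<Longrightarrow> \<bar>f x\<bar> \<le> e" by auto
    show "\<exists>d>0. \<forall>\<omega>\<in>space paths. \<omega> j < d \<longrightarrow> \<bar>F \<omega>\<bar> \<le> e"
    proof (intro exI[of _ d] conjI ballI impI d(1))
      fix \<omega> assume "\<omega> \<in> space paths" "\<omega> j < d"
      then show "\<bar>F \<omega>\<bar> \<le> e"
        unfolding F_def using j by (intro d(2) cube_path_topspace) (auto simp: space_paths ennreal_less_iff)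
    qed
  qed
  have p: "c \<ge> 0 \<Longrightarrow> stopped 0 (\<lambda>_. c) \<in> space paths" for c
    by (simp add: space_paths stopped_def)
  have "(\<lambda>n. iter_integral (scaled_kernel K (t n)) F m 0 (stopped 0 (\<lambda>_. u (t n))))
      \<longlonglongrightarrow> iter_integral (tail_kernel G H) F m 0 (stopped 0 (\<lambda>_. u0))"
  proof (rule iter_integral_tendsto[OF G H K KG t t0 F FB _ small])
    show "(\<lambda>n. F (z n)) \<longlonglongrightarrow> F \<omega>" if "\<And>j. (\<lambda>n. z n j) \<longlonglongrightarrow> \<omega> j" for \<omega> z
      unfolding F_def using that by (rule cube_path_tendsto[OF f])
    show "(\<lambda>n. stopped 0 (\<lambda>_. u (t n)) j) \<longlonglongrightarrow> stopped 0 (\<lambda>_. u0) j" for j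
      using ut by (simp add: stopped_def)
    show "stopped 0 (\<lambda>_. u0) \<in> space paths" using u0 by (intro p) simp
    show "stopped 0 (\<lambda>_. u (t n)) \<in> space paths" for n by (intro p u_nonneg t0)
    show "0 < stopped 0 (\<lambda>_. u0) 0" using u0 by (simp add: stopped_def)
  qed simp
  moreover have "(\<integral>x. f x \<partial>pi_tail Q T m u0) = iter_integral (tail_kernel G H) F m 0 (stopped 0 (\<lambda>_. u0))"
  proof -
    have "(\<integral>x. f x \<partial>pi_tail Q T m u0)
        = iter_integral (scaled_kernel (tail_kernel G H) 1) F m 0 (stopped 0 (\<lambda>_. u0))"
      using chain_cube_expectation[OF K0 T[of u0] zero_less_one _ f] u0 by (simp add: pi_tail_def F_def)
    also have "\<dots> = iter_integral (tail_kernel G H) F m 0 (stopped 0 (\<lambda>_. u0))"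
      using u0 by (intro iter_integral_cong_kernel[OF scaled_kernel_1[OF K0]]
          scaled_kernel_measurable[OF K0 zero_less_one] p) auto
    finally show ?thesis .
  qed
  moreover have "(\<integral>x. f x \<partial>pi_scaled P X m (t n) (u (t n)))
      = iter_integral (scaled_kernel K (t n)) F m 0 (stopped 0 (\<lambda>_. u (t n)))" for n
  proof -
    have "0 \<le> t n * u (t n)" using t0 u_nonneg by (simp add: less_imp_le)
    from chain_cube_expectation[OF K X[OF this] t0 this f] show ?thesis
      using t0[of n] by (simp add: pi_scaled_def F_def)
  qed
  ultimately have "(\<lambda>n. \<integral>x. f x \<partial>pi_scaled P X m (t n) (u (t n))) \<longlonglongrightarrow> (\<integral>x. f x \<partial>pi_tail Q T m u0)"
    by simp
  moreover have "\<forall>\<^sub>F n in sequentially. (\<integral>x. f x \<partial>pi_scaled P X m (t n) (u (t n)))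
      = (\<integral>x. f x \<partial>pi_scaled P X m (\<tau> n) (u (\<tau> n)))"
    using filterlim_at_top[THEN iffD1, OF \<tau>, rule_format, of 1]
    by eventually_elim (simp add: t_def max_absorb1)
  ultimately show "(\<lambda>n. \<integral>x. f x \<partial>pi_scaled P X m (\<tau> n) (u (\<tau> n))) \<longlonglongrightarrow> (\<integral>x. f x \<partial>pi_tail Q T m u0)"
    by (rule Lim_transform_eventually)
qed

section \<open>Restriction to \<open>E' m\<close> and extension by zero\<close>

lemma E'_in_sets: "E' m \<in> sets (cube_borel m)"
  unfolding sets_cube_borel using openin_E' by (auto intro: sigma_sets.Basic)

lemma E'_subset: "E' m \<subseteq> topspace (cube_top m)"
  by (rule openin_subset[OF openin_E'])

text \<open>Finite total mass takes care of compact sets. As \<open>E' m\<close> is itself Borel,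
  the trace of the Borel sigma-algebra is generated by the traces of open sets, the open sets of the
  subspace.\<close>

lemma restrict_E'_radon:
  assumes \<pi>: "prob_space \<pi>" "sets \<pi> = sets (cube_borel m)"
  shows "restrict_space \<pi> (E' m) \<in> radon_measures (subtopology (cube_top m) (E' m))"
proof -
  let ?S = "subtopology (cube_top m) (E' m)"
  interpret prob_space \<pi> by fact
  have top: "topspace ?S = E' m"
    using E'_subset by (simp add: Int_absorb1)
  have E: "E' m \<in> sets \<pi>" using \<pi> E'_in_sets by simp
  have "sets (restrict_space \<pi> (E' m))
      = (\<inter>) (E' m) ` sigma_sets (topspace (cube_top m)) {U. openin (cube_top m) U}"
    by (simp only: sets_restrict_space \<pi> sets_cube_borel)
  also have "\<dots> = sigma_sets (E' m) ((\<inter>) (E' m) ` {U. openin (cube_top m) U})"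
    using E'_in_sets[of m] E'_subset[of m] by (intro sigma_sets_Int) (auto simp: sets_cube_borel)
  also have "(\<inter>) (E' m) ` {U. openin (cube_top m) U} = {U. openin ?S U}"
    by (auto simp: openin_subtopology)
  finally have sets: "sets (restrict_space \<pi> (E' m)) = sigma_sets (E' m) {U. openin ?S U}" .
  have "emeasure (restrict_space \<pi> (E' m)) C < \<infinity>" for C
    using finite_measure.emeasure_finite[OF finite_measure_restrict_space[OF finite_measure_axioms E]]
    by (simp add: less_top)
  then show ?thesis
    unfolding radon_measures_def top using sets space_restrict_space2[OF E] by blast
qed

text \<open>In a Hausdorff space the compact support is closed in the whole of \<open>X\<close>. The
  preimage of an open set is therefore open: it is open within \<open>U\<close>, joined with the
  complement of the support when the set contains 0.\<close>

lemma extend_by_zero_continuous: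
  fixes f :: "'a \<Rightarrow> real"
  assumes X: "Hausdorff_space X" and U: "openin X U"
    and f: "continuous_map (subtopology X U) euclideanreal f"
    and supp: "compactin (subtopology X U) (subtopology X U closure_of {x \<in> topspace (subtopology X U). f x \<noteq> 0})"
  shows "continuous_map X euclideanreal (\<lambda>x. if x \<in> U then f x else 0)"
proof -
  let ?C = "subtopology X U closure_of {x \<in> topspace (subtopology X U). f x \<noteq> 0}"
  have UX: "U \<subseteq> topspace X" by (rule openin_subset[OF U])
  have top: "topspace (subtopology X U) = U" using UX by (simp add: Int_absorb1)
  have C: "closedin X ?C"
    using supp by (intro compactin_imp_closedin[OF X]) (simp add: compactin_subtopology)
  have CU: "?C \<subseteq> U" using closure_of_subset_topspace[of "subtopology X U"] unfolding top .
  have f0: "f x = 0" if "x \<in> U" "x \<notin> ?C" for x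
    using closure_of_subset[of "{x \<in> U. f x \<noteq> 0}" "subtopology X U"] that unfolding top by auto
  show ?thesis unfolding continuous_map_def
  proof (intro conjI allI impI)
    fix W :: "real set" assume W: "openin euclideanreal W"
    have "openin (subtopology X U) {x \<in> topspace (subtopology X U). f x \<in> W}"
      by (rule openin_continuous_map_preimage[OF f W])
    then have o: "openin X {x \<in> U. f x \<in> W}"
      unfolding top using openin_trans_full U by blast
    show "openin X {x \<in> topspace X. (if x \<in> U then f x else 0) \<in> W}"
    proof (cases "0 \<in> W")
      case True
      then have "{x \<in> topspace X. (if x \<in> U then f x else 0) \<in> W} = {x \<in> U. f x \<in> W} \<union> (topspace X - ?C)"
        using UX CU f0 by auto
      then show ?thesis using o C by auto
    next
      case False
      then have "{x \<in> topspace X. (if x \<in> U then f x else 0) \<in> W} = {x \<in> U. f x \<in> W}"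
        using UX by auto
      then show ?thesis using o by simp
    qed
  qed simp
qed

theorem theorem3p1:
  fixes G H :: "real measure"
    and K :: "real \<Rightarrow> real measure"
    and P :: "real \<Rightarrow> 'a measure" and X :: "nat \<Rightarrow> 'a \<Rightarrow> real"
    and Q :: "real \<Rightarrow> 'b measure" and T :: "nat \<Rightarrow> 'b \<Rightarrow> real"
    and m :: nat and u :: "real \<Rightarrow> real" and u0 :: real
  assumes G: "G \<in> space (prob_algebra half_line)"
    and H: "H \<in> space (prob_algebra half_line)"
    and K: "K \<in> half_line \<rightarrow>\<^sub>M prob_algebra half_line"
    and KG: "in_domain_of_attraction K G"
    and X: "\<And>x. x \<ge> 0 \<Longrightarrow> markov_chain_from K x (P x) X"
    and T: "\<And>x. x \<ge> 0 \<Longrightarrow> markov_chain_from (tail_kernel G H) x (Q x) T"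
    and m: "m \<ge> 1"
    and u_nonneg: "\<And>t. t > 0 \<Longrightarrow> u t \<ge> 0"
    and u_lim: "(u \<longlongrightarrow> u0) at_top"
    and u0: "u0 > 0"
  shows "vague_conv_on (subtopology (cube_top m) (E' m))
           (\<lambda>t. mu_scaled P X m t (u t)) (mu_tail Q T m u0) at_top
       \<and> (measure G {0} = 0 \<longrightarrow>
           weak_conv_on (cube_top m) (\<lambda>t. pi_scaled P X m t (u t)) (pi_tail Q T m u0) at_top)"
proof
  note lim = cube_integral_tendsto[OF G H K KG X T u_nonneg u_lim u0]
  show "measure G {0} = 0 \<longrightarrow>
      weak_conv_on (cube_top m) (\<lambda>t. pi_scaled P X m t (u t)) (pi_tail Q T m u0) at_top"
    unfolding weak_conv_on_def by (intro impI allI lim) auto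
  have X': "markov_chain_from K (t * u t) (P (t * u t)) X" if "0 < t" for t
    using u_nonneg[OF that] that by (intro X) simp
  have prob: "prob_space (pi_scaled P X m t (u t))" if "0 < t" for t
    unfolding pi_scaled_def using X'[OF that]
    by (intro prob_space.prob_space_distr chain_cube_measurable[OF X'[OF that]]) (simp add: markov_chain_from_def)
  have tail: "prob_space (pi_tail Q T m u0)"
    unfolding pi_tail_def
    using prob_space.prob_space_distr[OF _ chain_cube_measurable[OF T[of u0], where m = m and t = 1]] T[of u0] u0
    by (simp add: markov_chain_from_def)
  let ?S = "subtopology (cube_top m) (E' m)"
  show "vague_conv_on ?S (\<lambda>t. mu_scaled P X m t (u t)) (mu_tail Q T m u0) at_top"
    unfolding vague_conv_on_def
  proof (intro conjI allI impI)
    \<comment> \<open>For \<open>t > 0\<close> the initial state \<open>t * u t\<close> is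
      nonnegative, so that \<open>P (t * u t)\<close> is known to be a chain law.\<close>
    show "\<forall>\<^sub>F t in at_top. mu_scaled P X m t (u t) \<in> radon_measures ?S"
      using eventually_gt_at_top[of 0]
    proof eventually_elim
      case (elim t)
      show ?case unfolding mu_scaled_def by (rule restrict_E'_radon[OF prob[OF elim]]) (simp add: pi_scaled_def)
    qed
    show "mu_tail Q T m u0 \<in> radon_measures ?S"
      unfolding mu_tail_def by (rule restrict_E'_radon[OF tail]) (simp add: pi_tail_def)
  next
    fix f :: "(nat \<Rightarrow> ennreal) \<Rightarrow> real"
    assume f: "continuous_map ?S euclideanreal f \<and> (\<forall>x\<in>topspace ?S. 0 \<le> f x) \<and>
      compactin ?S (?S closure_of {x \<in> topspace ?S. f x \<noteq> 0})"
    \<comment> \<open>Extension by zero turns the vague statement into convergence of integrals over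
      the whole cube, and \<open>?f\<close> vanishes off \<open>E' m\<close> by construction, as
      \<open>cube_integral_tendsto\<close> requires when \<open>G\<close> may charge 0.\<close>
    let ?f = "\<lambda>x. if x \<in> E' m then f x else 0"
    have "continuous_map (cube_top m) euclideanreal ?f"
      using f by (intro extend_by_zero_continuous[OF Hausdorff_space_cube_top openin_E']) auto
    then have L: "((\<lambda>t. \<integral>x. ?f x \<partial>pi_scaled P X m t (u t)) \<longlongrightarrow> (\<integral>x. ?f x \<partial>pi_tail Q T m u0)) at_top"
      by (intro lim) auto
    have restr: "(\<integral>x. f x \<partial>restrict_space \<pi> (E' m)) = (\<integral>x. ?f x \<partial>\<pi>)"
      if "sets \<pi> = sets (cube_borel m)" for \<pi>
      using that E'_in_sets[of m]
      by (subst integral_restrict_space) (auto intro!: Bochner_Integration.integral_cong simp: indicator_def)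
    show "((\<lambda>t. \<integral>x. f x \<partial>mu_scaled P X m t (u t)) \<longlongrightarrow> (\<integral>x. f x \<partial>mu_tail Q T m u0)) at_top"
      using L unfolding mu_scaled_def mu_tail_def
      by (simp add: restr pi_scaled_def pi_tail_def)
  qed
qed

end
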